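(* Let $n_1,\ldots,n_k$ be integers larger than or equal to $2$ and let $m=\prod_{i=1}^k n_i$. Suppose $\phi:M_m\to M_m$ is a linear map. If $$\operatorname{rank}(\phi(A_1\otimes\cdots\otimes A_k))=1\quad\text{whenever}\quad\operatorname{rank}(A_1\otimes\cdots\otimes A_k)=1,\qquad A_i\in M_{n_i},\ i=1,\dots,k,$$ and there is a matrix $X_1\otimes\cdots\otimes X_k$ with $X_i\in M_{n_i}$ and $\operatorname{rank}X_i>1$ for $i=1,\dots,k$ such that $$\operatorname{rank}(\phi(X_1\otimes\cdots\otimes X_k))=\operatorname{rank}(X_1\otimes\cdots\otimes X_k),$$ then $\phi$ has the form $$\phi(A_1\otimes\cdots\otimes A_k)=M(\psi_1(A_1)\otimes\cdots\otimes\psi_k(A_k))N^T\quad\text{for all }A_i\in M_{n_i},\ i=1,\dots,k,$$ where, for each $j=1,\dots,k$, $\psi_j:M_{n_j}\to M_{n_j}$ is the identity map or the transpose map, and $M,N\in M_m$ satisfy $$\operatorname{Ker}(M)\cap\mathcal S(\mathbb C^{n_1}\otimes\cdots\otimes\mathbb C^{n_k})=\{0\}\quad\text{and}\quad\operatorname{Ker}(N)\cap\mathcal S(\mathbb C^{n_1}\otimes\cdots\otimes\mathbb C^{n_k})=\{0\}.$$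
   Context: $M_n$ is the space of $n\times n$ complex matrices; $\otimes$ is the Kronecker product, $A\otimes B=[a_{ij}B]$, and $\mathbb C^{a}\otimes\mathbb C^{b}$ is identified with $\mathbb C^{ab}$ via the Kronecker product of column vectors. $\mathcal S(\mathbb C^{n_1}\otimes\cdots\otimes\mathbb C^{n_k})=\{x_1\otimes\cdots\otimes x_k:x_i\in\mathbb C^{n_i}\}$ is the set of decomposable vectors (including $0$). *)

theory Defs
  imports
    Complex_Main
    "Jordan_Normal_Form.DL_Rank"
    "Jordan_Normal_Form.Matrix_Kernel"
begin

(* The rank of a matrix in the locale vec_space takes the length of the columns as a parameter. *)
abbreviation mat_rank :: "'a :: field mat \<Rightarrow> nat" where
  "mat_rank A \<equiv> vec_space.rank (dim_row A) A"

definition kron_mat :: "'a :: times mat \<Rightarrow> 'a mat \<Rightarrow> 'a mat" (infixl \<open>\<otimes>\<^sub>m\<close> 70) where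
  "A \<otimes>\<^sub>m B = mat (dim_row A * dim_row B) (dim_col A * dim_col B)
     (\<lambda>(i, j). A $$ (i div dim_row B, j div dim_col B) * B $$ (i mod dim_row B, j mod dim_col B))"

definition kron_vec :: "'a :: times vec \<Rightarrow> 'a vec \<Rightarrow> 'a vec" (infixl \<open>\<otimes>\<^sub>v\<close> 70) where
  "x \<otimes>\<^sub>v y = vec (dim_vec x * dim_vec y) (\<lambda>i. x $ (i div dim_vec y) * y $ (i mod dim_vec y))"

(* kron_mats k A is the product of A 1, ..., A k (the index starts at 1; the value A 0 is not used). *)
primrec kron_mats :: "nat \<Rightarrow> (nat \<Rightarrow> 'a :: semiring_1 mat) \<Rightarrow> 'a mat" where
  "kron_mats 0 A = 1\<^sub>m 1"
| "kron_mats (Suc k) A = kron_mats k A \<otimes>\<^sub>m A (Suc k)"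

primrec kron_vecs :: "nat \<Rightarrow> (nat \<Rightarrow> 'a :: semiring_1 vec) \<Rightarrow> 'a vec" where
  "kron_vecs 0 x = unit_vec 1 0"
| "kron_vecs (Suc k) x = kron_vecs k x \<otimes>\<^sub>v x (Suc k)"

definition decomposable_vecs :: "nat \<Rightarrow> (nat \<Rightarrow> nat) \<Rightarrow> complex vec set" where
  "decomposable_vecs k n = {kron_vecs k x | x. \<forall>i\<in>{1..k}. x i \<in> carrier_vec (n i)}"

abbreviation linear_map_mat :: "nat \<Rightarrow> (complex mat \<Rightarrow> complex mat) \<Rightarrow> bool" where
  "linear_map_mat m \<phi> \<equiv>
     linear_map class_ring (module_mat TYPE(complex) m m) (module_mat TYPE(complex) m m) \<phi>"

lemma vectorspace_module_mat: "vectorspace class_ring (module_mat TYPE('a :: field) nr nc)"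
proof -
  interpret abelian_group "module_mat TYPE('a) nr nc" by (rule abelian_group_mat)
  interpret R: field "class_ring :: 'a ring" by (rule class_field)
  show ?thesis
    by unfold_locales
       (auto simp: module_mat_def add_smult_distrib_right_mat add_smult_distrib_left_mat)
qed

lemma linear_map_mat_iff:
  "linear_map_mat m \<phi> \<longleftrightarrow>
     \<phi> \<in> carrier_mat m m \<rightarrow> carrier_mat m m \<and>
     (\<forall>A\<in>carrier_mat m m. \<forall>B\<in>carrier_mat m m. \<phi> (A + B) = \<phi> A + \<phi> B) \<and>
     (\<forall>c. \<forall>A\<in>carrier_mat m m. \<phi> (c \<cdot>\<^sub>m A) = c \<cdot>\<^sub>m \<phi> A)"
  using vectorspace_module_mat[where 'a = complex, of m m]
  by (auto simp: linear_map_def mod_hom_def mod_hom_axioms_def vectorspace_def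
      LinearCombinations.module_hom_def module_mat_def)

lemma kron_mats_Suc_0: "kron_mats (Suc 0) A = A (Suc 0)"
  by (rule eq_matI) (auto simp: kron_mat_def)

lemma kron_vecs_Suc_0: "kron_vecs (Suc 0) x = x (Suc 0)"
  by (rule eq_vecI) (auto simp: kron_vec_def)

lemma kron_mats_carrier:
  assumes "\<And>i. i \<in> {1..k} \<Longrightarrow> A i \<in> carrier_mat (n i) (n i)"
  shows "kron_mats k A \<in> carrier_mat (\<Prod>i=1..k. n i) (\<Prod>i=1..k. n i)"
  using assms by (induction k) (fastforce simp: kron_mat_def)+

lemma kron_vecs_carrier:
  assumes "\<And>i. i \<in> {1..k} \<Longrightarrow> x i \<in> carrier_vec (n i)"
  shows "kron_vecs k x \<in> carrier_vec (\<Prod>i=1..k. n i)"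
  using assms by (induction k) (fastforce simp: kron_vec_def)+

end

theory Submission
  imports Defs "HOL-Library.FuncSet"
begin

text \<open>On products of outer products \<open>x\<^sub>i y\<^sub>i\<^sup>T\<close> the map \<open>\<phi>\<close> is multilinear in \<open>2k\<close> vector slots and takes
  values of rank one. When only one slot varies, the values share either their row space or their column
  space, and which of the two happens does not depend on the other slots. Hence the value factors as
  \<open>f g\<^sup>T\<close>, where \<open>f\<close> depends on the slots of the first kind and \<open>g\<close> on the remaining ones. If \<open>x\<^sub>j\<close>
  and \<open>y\<^sub>j\<close> were of the same kind, then the factor \<open>X\<^sub>j\<close> would not contribute to the rank of
  \<open>\<phi> (X\<^sub>1 \<otimes> \<dots> \<otimes> X\<^sub>k)\<close>, which would be smaller than the rank of \<open>X\<^sub>1 \<otimes> \<dots> \<otimes> X\<^sub>k\<close>. So each \<open>j\<close> has one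
  slot of each kind, and the order of the two kinds decides whether \<open>\<psi>\<^sub>j\<close> is the identity or the
  transpose map.\<close>

section \<open>Multilinear maps with values of rank one\<close>

text \<open>Rank one values alone do not separate the two slots of a factor. For two factors of
  equal size the realignment map, A \<otimes> B \<mapsto> vec(A) vec(B)^T, also sends products of
  rank one to matrices of rank one, but it puts both slots of each factor on the same side. Counting
  the outer products that make up \<phi>(X) excludes such maps. The kind of a slot is stable because
  each slot has dimension at least 2: a plane holds three pairwise independent vectors, one more
  than there are kinds. Common row and column spaces determine a value only up to a scalar, which
  might depend on all slots at once. Linearity in one slot at a time shows that it is constant,
  starting from a base point where both sides agree. M and N collect the values of f and g at unit
  vectors. Their kernels avoid nonzero decomposable vectors v because \<phi> maps v v^T to (M v)(N
  v)^T, and this value has rank one.\<close>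

lemma rank_one_factor:
  fixes A :: "'a \<Rightarrow> 'b \<Rightarrow> complex"
  assumes "\<And>p q p' q'. A p q * A p' q' = A p q' * A p' q" and "A p0 q0 \<noteq> 0"
  obtains u v where "\<And>p q. A p q = u p * v q" and "u p0 \<noteq> 0" and "v q0 \<noteq> 0"
proof
  show "A p q = A p q0 * (A p0 q / A p0 q0)" for p q
    using assms(1)[of p q p0 q0] assms(2) by (simp add: field_simps)
qed (use assms(2) in auto)

text \<open>If \<open>P x y\<close> fails, then \<open>Q x y\<close> holds, and no \<open>w\<close>
  is \<open>P\<close>-related to both \<open>x\<close> and \<open>y\<close>. So every
  \<open>w\<close> is \<open>Q\<close>-related to one of them, hence to \<open>x\<close>, and
  \<open>Q\<close> is total.\<close>

lemma total_equivalence_dichotomy: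
  assumes "\<And>x y. x \<in> X \<Longrightarrow> y \<in> X \<Longrightarrow> P x y \<or> Q x y"
    and "\<And>x y. x \<in> X \<Longrightarrow> y \<in> X \<Longrightarrow> P x y \<Longrightarrow> P y x"
    and "\<And>x y. x \<in> X \<Longrightarrow> y \<in> X \<Longrightarrow> Q x y \<Longrightarrow> Q y x"
    and "\<And>x y z. x \<in> X \<Longrightarrow> y \<in> X \<Longrightarrow> z \<in> X \<Longrightarrow> P x y \<Longrightarrow> P y z \<Longrightarrow> P x z"
    and "\<And>x y z. x \<in> X \<Longrightarrow> y \<in> X \<Longrightarrow> z \<in> X \<Longrightarrow> Q x y \<Longrightarrow> Q y z \<Longrightarrow> Q x z"
  shows "(\<forall>x\<in>X. \<forall>y\<in>X. P x y) \<or> (\<forall>x\<in>X. \<forall>y\<in>X. Q x y)"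
  using assms by meson

text \<open>All 2x2 minors built from one row of \<open>A\<close> and one row of \<open>B\<close>
  vanish: for nonzero matrices this means rank one with a common row space. The zero matrix is
  related to everything, so transitivity needs a nonzero matrix in the middle.\<close>

definition same_rows :: "('a \<Rightarrow> 'b \<Rightarrow> complex) \<Rightarrow> ('a \<Rightarrow> 'b \<Rightarrow> complex) \<Rightarrow> bool" where
  "same_rows A B \<longleftrightarrow> (\<forall>p q p' q'. A p q * B p' q' = A p q' * B p' q)"

definition same_cols :: "('a \<Rightarrow> 'b \<Rightarrow> complex) \<Rightarrow> ('a \<Rightarrow> 'b \<Rightarrow> complex) \<Rightarrow> bool" where
  "same_cols A B \<longleftrightarrow> (\<forall>p q p' q'. A p q * B p' q' = A p' q * B p q')"

lemma same_cols_transpose: "same_cols A B \<longleftrightarrow> same_rows (\<lambda>q p. A p q) (\<lambda>q p. B p q)"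
  by (auto simp: same_rows_def same_cols_def)

lemma same_rows_sym: "same_rows A B \<Longrightarrow> same_rows B A"
  by (simp add: same_rows_def mult.commute)

lemma same_cols_sym: "same_cols A B \<Longrightarrow> same_cols B A"
  by (simp add: same_cols_def mult.commute)

lemma same_rows_trans:
  assumes AB: "same_rows A B" and BC: "same_rows B C" and B: "B p0 q0 \<noteq> 0"
  shows "same_rows A C"
  unfolding same_rows_def
proof (intro allI)
  fix p q p' q'
  have 1: "A p q = A p q0 * B p0 q / B p0 q0" for p q
    using AB B by (simp add: same_rows_def field_simps)
  have 2: "C p q = C p q0 * B p0 q / B p0 q0" for p q
    using BC B by (simp add: same_rows_def field_simps)
  show "A p q * C p' q' = A p q' * C p' q"
    using 1[of p q] 1[of p q'] 2[of p' q] 2[of p' q'] by simp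
qed

lemma same_cols_trans:
  assumes "same_cols A B" and "same_cols B C" and "B p0 q0 \<noteq> 0"
  shows "same_cols A C"
  using assms same_rows_trans unfolding same_cols_transpose by fast

text \<open>For \<open>A\<close> = u v^T and \<open>B\<close> = s t^T each 2x2 minor of the sum is
  the product of a minor of (u, s) and a minor of (v, t). One nonvanishing minor of (u, s) therefore
  makes v and t parallel.\<close>

lemma rank_one_sum:
  fixes A B :: "'a \<Rightarrow> 'b \<Rightarrow> complex"
  assumes A: "\<And>p q p' q'. A p q * A p' q' = A p q' * A p' q" "A p0 q0 \<noteq> 0"
    and B: "\<And>p q p' q'. B p q * B p' q' = B p q' * B p' q" "B p1 q1 \<noteq> 0"
    and AB: "\<And>p q p' q'. (A p q + B p q) * (A p' q' + B p' q') = (A p q' + B p q') * (A p' q + B p' q)"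
  shows "same_rows A B \<or> same_cols A B"
proof -
  obtain u v where uv: "\<And>p q. A p q = u p * v q" using rank_one_factor[of A p0 q0, OF A] by metis
  obtain s t where st: "\<And>p q. B p q = s p * t q" using rank_one_factor[of B p1 q1, OF B] by metis
  have *: "(u p * s p' - u p' * s p) * (v q * t q' - v q' * t q) = 0" for p p' q q'
    using AB[of p q p' q'] unfolding uv st by (simp add: algebra_simps)
  show ?thesis
  proof (cases "\<forall>p p'. u p * s p' = u p' * s p")
    case True
    have "same_cols A B" unfolding same_cols_def uv st
    proof (intro allI)
      fix p q p' q'
      show "u p * v q * (s p' * t q') = u p' * v q * (s p * t q')"
        using True[rule_format, of p p'] by (metis mult.assoc mult.commute)
    qed
    then show ?thesis ..
  next
    case False
    then obtain p p' where "u p * s p' - u p' * s p \<noteq> 0" by auto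
    then have V: "v q * t q' = v q' * t q" for q q' using *[of p p' q q'] by auto
    have "same_rows A B" unfolding same_rows_def uv st
    proof (intro allI)
      fix p q p' q'
      show "u p * v q * (s p' * t q') = u p * v q' * (s p' * t q)"
        using V[of q q'] by (metis mult.assoc mult.commute)
    qed
    then show ?thesis ..
  qed
qed

text \<open>A vector in slot \<open>s\<close> is a function of which only the values below
  \<open>d s\<close> count (\<open>cong\<close>), so that slots can be changed by function update.
  Together, \<open>minors\<close> and \<open>nonzero\<close> express rank one at arguments without a
  zero slot. The assumptions are symmetric under transposition of the values.\<close>

locale rank_one_multilinear =
  fixes S :: "'s set" and d :: "'s \<Rightarrow> nat"
    and F :: "('s \<Rightarrow> nat \<Rightarrow> complex) \<Rightarrow> 'a \<Rightarrow> 'b \<Rightarrow> complex"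
  assumes fin: "finite S"
    and dim: "s \<in> S \<Longrightarrow> 2 \<le> d s"
    and cong: "(\<And>s t. s \<in> S \<Longrightarrow> t < d s \<Longrightarrow> z s t = z' s t) \<Longrightarrow> F z = F z'"
    and linear: "s \<in> S \<Longrightarrow>
      F (z(s := \<lambda>t. a * x t + b * y t)) p q = a * F (z(s := x)) p q + b * F (z(s := y)) p q"
    and minors: "F z p q * F z p' q' = F z p q' * F z p' q"
    and nonzero: "(\<And>s. s \<in> S \<Longrightarrow> \<exists>t<d s. z s t \<noteq> 0) \<Longrightarrow> \<exists>p q. F z p q \<noteq> 0"
begin

definition nz :: "'s \<Rightarrow> (nat \<Rightarrow> complex) set" where
  "nz s = {x. \<exists>t<d s. x t \<noteq> 0}"

definition NZ :: "('s \<Rightarrow> nat \<Rightarrow> complex) set" where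
  "NZ = {z. \<forall>s\<in>S. z s \<in> nz s}"

lemma NZ_upd: "z \<in> NZ \<Longrightarrow> x \<in> nz s \<Longrightarrow> z(s := x) \<in> NZ"
  by (auto simp: NZ_def)

lemma NZ_nonzero: "z \<in> NZ \<Longrightarrow> \<exists>p q. F z p q \<noteq> 0"
  by (rule nonzero) (auto simp: NZ_def nz_def)

lemma transpose: "rank_one_multilinear S d (\<lambda>z q p. F z p q)"
proof
  show "\<exists>p q. F z q p \<noteq> 0" if "\<And>s. s \<in> S \<Longrightarrow> \<exists>t<d s. z s t \<noteq> 0" for z
    using nonzero[of z] that by blast
  show "(\<lambda>q p. F z p q) = (\<lambda>q p. F z' p q)"
    if "\<And>s t. s \<in> S \<Longrightarrow> t < d s \<Longrightarrow> z s t = z' s t" for z z'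
    using cong[of z z'] that by simp
  show "F z q p * F z q' p' = F z q' p * F z q p'" for z p q p' q'
    using minors[of z q p q' p'] by (simp add: mult.commute)
qed (use fin dim linear in auto)

lemma not_nz_zero:
  assumes "s \<in> S" "x \<notin> nz s" shows "F (z(s := x)) p q = 0"
proof -
  have "F (z(s := x)) = F (z(s := \<lambda>t. 0 * x t + 0 * x t))"
    using assms by (intro cong) (auto simp: nz_def)
  then show ?thesis using linear[OF assms(1), of z 0 x 0 x] by simp
qed

lemma not_NZ_zero:
  assumes "z \<notin> NZ" shows "F z p q = 0"
proof -
  from assms obtain s where "s \<in> S" "z s \<notin> nz s" by (auto simp: NZ_def)
  then show ?thesis using not_nz_zero[of s "z s" z] by simp
qed

lemma rows_or_cols:
  assumes s: "s \<in> S" and z: "z \<in> NZ" and x: "x \<in> nz s" and y: "y \<in> nz s"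
  shows "same_rows (F (z(s := x))) (F (z(s := y))) \<or> same_cols (F (z(s := x))) (F (z(s := y)))"
proof -
  obtain p0 q0 where 0: "F (z(s := x)) p0 q0 \<noteq> 0" using NZ_nonzero NZ_upd[OF z x] by blast
  obtain p1 q1 where 1: "F (z(s := y)) p1 q1 \<noteq> 0" using NZ_nonzero NZ_upd[OF z y] by blast
  have lin: "F (z(s := \<lambda>t. 1 * x t + 1 * y t)) p q = F (z(s := x)) p q + F (z(s := y)) p q" for p q
    unfolding linear[OF s] by simp
  show ?thesis
    using rank_one_sum[where A = "F (z(s := x))" and B = "F (z(s := y))"] 0 1 minors
    unfolding lin[symmetric] by blast
qed

section \<open>The two kinds of slots\<close>

definition left_at :: "'s \<Rightarrow> ('s \<Rightarrow> nat \<Rightarrow> complex) \<Rightarrow> bool" where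
  "left_at s z \<longleftrightarrow> (\<forall>x\<in>nz s. \<forall>y\<in>nz s. same_rows (F (z(s := x))) (F (z(s := y))))"

definition right_at :: "'s \<Rightarrow> ('s \<Rightarrow> nat \<Rightarrow> complex) \<Rightarrow> bool" where
  "right_at s z \<longleftrightarrow> (\<forall>x\<in>nz s. \<forall>y\<in>nz s. same_cols (F (z(s := x))) (F (z(s := y))))"

text \<open>\<open>rows_or_cols\<close> decides pair by pair. Values on \<open>NZ\<close> are
  nonzero, so both relations are transitive there, and the dichotomy for two equivalence relations
  makes the decision uniform in the slot.\<close>

lemma left_or_right:
  assumes s: "s \<in> S" and z: "z \<in> NZ"
  shows "left_at s z \<or> right_at s z"
  unfolding left_at_def right_at_def
proof (rule total_equivalence_dichotomy)
  fix x y w assume xyw: "x \<in> nz s" "y \<in> nz s" "w \<in> nz s"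
  obtain p q where "F (z(s := y)) p q \<noteq> 0" using NZ_nonzero NZ_upd[OF z xyw(2)] by blast
  then show
    "same_rows (F (z(s := x))) (F (z(s := y))) \<Longrightarrow> same_rows (F (z(s := y))) (F (z(s := w))) \<Longrightarrow>
      same_rows (F (z(s := x))) (F (z(s := w)))"
    "same_cols (F (z(s := x))) (F (z(s := y))) \<Longrightarrow> same_cols (F (z(s := y))) (F (z(s := w))) \<Longrightarrow>
      same_cols (F (z(s := x))) (F (z(s := w)))"
    by (metis same_rows_trans, metis same_cols_trans)
qed (use rows_or_cols[OF s z] same_rows_sym same_cols_sym in auto)


text \<open>Linear independence of the truncations of \<open>x\<close> and \<open>y\<close> to their
  first \<open>d s\<close> entries.\<close>

definition indep :: "'s \<Rightarrow> (nat \<Rightarrow> complex) \<Rightarrow> (nat \<Rightarrow> complex) \<Rightarrow> bool" where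
  "indep s x y \<longleftrightarrow> (\<forall>a b. a \<noteq> 0 \<or> b \<noteq> 0 \<longrightarrow> (\<lambda>t. a * x t + b * y t) \<in> nz s)"

text \<open>The first two unit vectors serve; this is where dimension at least 2 enters.\<close>

lemma exists_indep:
  assumes "s \<in> S" shows "\<exists>x y. indep s x y"
proof (intro exI)
  show "indep s (\<lambda>t. if t = 0 then 1 else 0) (\<lambda>t. if t = 1 then 1 else 0)"
    unfolding indep_def
  proof (intro allI impI)
    fix a b :: complex assume ab: "a \<noteq> 0 \<or> b \<noteq> 0"
    show "(\<lambda>t. a * (if t = 0 then 1 else 0) + b * (if t = 1 then 1 else 0)) \<in> nz s"
    proof (cases "a = 0")
      case True
      then show ?thesis using ab dim[OF assms] by (auto simp: nz_def intro!: exI[of _ 1])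
    next
      case False
      then show ?thesis using ab dim[OF assms] by (auto simp: nz_def intro!: exI[of _ 0])
    qed
  qed
qed

lemma indep_nz:
  assumes "indep s x y" shows "x \<in> nz s" and "y \<in> nz s"
proof -
  have "(\<lambda>t. 1 * x t + 0 * y t) \<in> nz s" "(\<lambda>t. 0 * x t + 1 * y t) \<in> nz s"
    using assms unfolding indep_def by (metis zero_neq_one)+
  then show "x \<in> nz s" "y \<in> nz s" by simp_all
qed

text \<open>Makes \<open>x\<close>, \<open>y\<close> and their sum pairwise independent: three
  vectors for a pigeonhole argument with two alternatives.\<close>

lemma indep_add:
  assumes "indep s x y"
  shows "indep s x (\<lambda>t. x t + y t)" and "indep s y (\<lambda>t. x t + y t)"
proof -
  have "(\<lambda>t. (a + b) * x t + b * y t) \<in> nz s" "(\<lambda>t. b * x t + (a + b) * y t) \<in> nz s"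
    if "a \<noteq> 0 \<or> b \<noteq> 0" for a b
  proof -
    have "a + b \<noteq> 0 \<or> b \<noteq> 0" using that by auto
    then show "(\<lambda>t. (a + b) * x t + b * y t) \<in> nz s" "(\<lambda>t. b * x t + (a + b) * y t) \<in> nz s"
      using assms unfolding indep_def by blast+
  qed
  then show "indep s x (\<lambda>t. x t + y t)" "indep s y (\<lambda>t. x t + y t)"
    unfolding indep_def by (simp_all add: algebra_simps)
qed

text \<open>Rank one matrices with the same row space and the same column space are proportional. By
  linearity a nontrivial combination of \<open>x\<close> and \<open>y\<close> would then give the
  value zero, although it is a nonzero vector.\<close>

lemma not_rows_and_cols:
  assumes s: "s \<in> S" and z: "z \<in> NZ" and xy: "indep s x y"
  shows "\<not> (same_rows (F (z(s := x))) (F (z(s := y))) \<and> same_cols (F (z(s := x))) (F (z(s := y))))"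
proof
  let ?A = "F (z(s := x))" and ?B = "F (z(s := y))"
  assume *: "same_rows ?A ?B \<and> same_cols ?A ?B"
  obtain p0 q0 where 0: "?A p0 q0 \<noteq> 0" using NZ_nonzero NZ_upd[OF z indep_nz(1)[OF xy]] by blast
  have "- ?B p0 q0 * ?A p q + ?A p0 q0 * ?B p q = 0" for p q
  proof -
    have "?A p0 q0 * ?B p q = ?A p q0 * ?B p0 q" using * by (simp add: same_cols_def)
    moreover have "?A p0 q0 * ?B p0 q = ?A p0 q * ?B p0 q0" using * by (simp add: same_rows_def)
    moreover have "?A p q * ?A p0 q0 = ?A p q0 * ?A p0 q" by (rule minors)
    \<comment> \<open>Here \<open>a\<close>, \<open>b\<close> are the entries of \<open>?A\<close>,
      \<open>?B\<close> at (p, q), \<open>a0\<close>, \<open>c\<close> those at (p0, q0), and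
      \<open>x\<close>, \<open>y\<close>, \<open>w\<close> are the mixed entries
      \<open>?A p q0\<close>, \<open>?B p0 q\<close>, \<open>?A p0 q\<close>. Multiply the first
      equation by \<open>a0\<close>, substitute the other two and cancel.\<close>
    moreover have "b = c * a / a0" if "a0 * b = x * y" "a0 * y = w * c" "a * a0 = x * w" "a0 \<noteq> 0"
      for a a0 b c x y w :: complex
      using that by (simp add: field_simps) (metis mult.assoc mult.commute mult_left_cancel)
    ultimately have "?B p q = ?B p0 q0 * ?A p q / ?A p0 q0" using 0 by blast
    then show ?thesis using 0 by simp
  qed
  then have "F (z(s := \<lambda>t. - ?B p0 q0 * x t + ?A p0 q0 * y t)) p q = 0" for p q
    unfolding linear[OF s] .
  moreover have "z(s := \<lambda>t. - ?B p0 q0 * x t + ?A p0 q0 * y t) \<in> NZ"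
    using xy 0 unfolding indep_def by (intro NZ_upd z) blast
  ultimately show False using NZ_nonzero by blast
qed

text \<open>Suppose slot \<open>s\<close> moves the column factor (\<open>left_at\<close>) before the change of slot \<open>t\<close> and the
  row factor (\<open>right_at\<close>) after it. For each of three pairwise independent arguments of slot \<open>s\<close>, the
  change at \<open>t\<close> preserves the row factor or the column factor. Two of them agree in this choice, and then
  their matrices are proportional before or after the change.\<close>

lemma left_at_upd:
  assumes s: "s \<in> S" and t: "t \<in> S" and z: "z \<in> NZ" and w: "w \<in> nz t" and left: "left_at s z"
  shows "left_at s (z(t := w))"
proof (rule ccontr)
  assume not_left: "\<not> left_at s (z(t := w))"
  \<comment> \<open>\<open>left_at s\<close> overwrites slot \<open>s\<close>, so it cannot notice a
    change of that slot.\<close>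
  then have st: "s \<noteq> t" using left by (auto simp: left_at_def)
  have zw: "z(t := w) \<in> NZ" using NZ_upd z w by blast
  then have right: "right_at s (z(t := w))" using left_or_right[OF s zw] not_left by blast
  define G where "G x = F (z(s := x))" for x
  define H where "H x = F (z(t := w, s := x))" for x
  have zt: "z t \<in> nz t" using z t by (simp add: NZ_def)
  have GH: "same_rows (G x) (H x) \<or> same_cols (G x) (H x)" if "x \<in> nz s" for x
  proof -
    have "z(s := x, t := z t) = z(s := x)" using st by auto
    then show ?thesis
      using rows_or_cols[OF t NZ_upd[OF z that] zt w] st by (simp add: G_def H_def fun_upd_twist)
  qed
  have G0: "\<exists>p q. G x p q \<noteq> 0" and H0: "\<exists>p q. H x p q \<noteq> 0" if "x \<in> nz s" for x
    using that NZ_nonzero NZ_upd z zw by (auto simp: G_def H_def)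
  have no_rows: "\<not> (same_rows (G x) (H x) \<and> same_rows (G y) (H y))" if "indep s x y" for x y
  proof
    assume *: "same_rows (G x) (H x) \<and> same_rows (G y) (H y)"
    have xy: "x \<in> nz s" "y \<in> nz s" using indep_nz[OF that] by auto
    have "same_rows (G x) (G y)" using left xy by (simp add: left_at_def G_def)
    then have "same_rows (H x) (H y)"
      using * G0[OF xy(1)] G0[OF xy(2)] by (metis same_rows_trans same_rows_sym)
    moreover have "same_cols (H x) (H y)" using right xy by (simp add: right_at_def H_def)
    ultimately show False using not_rows_and_cols[OF s zw that] by (simp add: H_def)
  qed
  have no_cols: "\<not> (same_cols (G x) (H x) \<and> same_cols (G y) (H y))" if "indep s x y" for x y
  proof
    assume *: "same_cols (G x) (H x) \<and> same_cols (G y) (H y)"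
    have xy: "x \<in> nz s" "y \<in> nz s" using indep_nz[OF that] by auto
    have "same_cols (H x) (H y)" using right xy by (simp add: right_at_def H_def)
    then have "same_cols (G x) (G y)"
      using * H0[OF xy(1)] H0[OF xy(2)] by (metis same_cols_trans same_cols_sym)
    moreover have "same_rows (G x) (G y)" using left xy by (simp add: left_at_def G_def)
    ultimately show False using not_rows_and_cols[OF s z that] by (simp add: G_def)
  qed
  obtain x y where xy: "indep s x y" using exists_indep[OF s] by blast
  note i = indep_add[OF xy]
  show False
    using GH[OF indep_nz(1)[OF xy]] GH[OF indep_nz(2)[OF xy]] GH[OF indep_nz(2)[OF i(1)]]
      no_rows[OF xy] no_rows[OF i(1)] no_rows[OF i(2)] no_cols[OF xy] no_cols[OF i(1)] no_cols[OF i(2)]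
    by blast
qed

text \<open>Slots are exchanged one at a time. Every intermediate argument stays in
  \<open>NZ\<close>, so its value is nonzero and may serve as the middle term of a transitivity
  step.\<close>

lemma NZ_override_induct:
  assumes "z \<in> NZ" and "z' \<in> NZ" and "T \<subseteq> S" and "P z"
    and step: "\<And>z s x. z \<in> NZ \<Longrightarrow> s \<in> T \<Longrightarrow> x \<in> nz s \<Longrightarrow> P z \<Longrightarrow> P (z(s := x))"
  shows "override_on z z' T \<in> NZ \<and> P (override_on z z' T)"
proof -
  have "finite T" using fin \<open>T \<subseteq> S\<close> finite_subset by blast
  then show ?thesis using \<open>T \<subseteq> S\<close> step
  proof (induction T)
    case (insert t T)
    have t: "z' t \<in> nz t" using insert.prems \<open>z' \<in> NZ\<close> by (auto simp: NZ_def)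
    have IH: "override_on z z' T \<in> NZ \<and> P (override_on z z' T)" using insert by blast
    show ?case unfolding override_on_insert
      using NZ_upd[OF _ t] insert.prems(2)[OF _ _ t] IH by blast
  qed (use assms in auto)
qed

lemma left_at_const:
  assumes s: "s \<in> S" and z: "z \<in> NZ" and z': "z' \<in> NZ" and "left_at s z"
  shows "left_at s z'"
proof -
  have "left_at s (override_on z z' S)"
    using NZ_override_induct[where P = "left_at s" and T = S, OF z z'] left_at_upd[OF s] assms by blast
  \<comment> \<open>The override agrees with \<open>z'\<close> on \<open>S\<close> only;
    \<open>cong\<close> disposes of the rest.\<close>
  moreover have "F ((override_on z z' S)(s := x)) = F (z'(s := x))" for x
    by (rule cong) (auto simp: override_on_def)
  ultimately show ?thesis by (simp add: left_at_def)
qed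

lemma same_rows_override:
  assumes z: "z \<in> NZ" and z': "z' \<in> NZ" and T: "T \<subseteq> S" and left: "\<And>s z. s \<in> T \<Longrightarrow> z \<in> NZ \<Longrightarrow> left_at s z"
  shows "same_rows (F z) (F (override_on z z' T))"
proof -
  let ?P = "\<lambda>w. same_rows (F z) (F w)"
  have "?P (w(s := x))" if "w \<in> NZ" "s \<in> T" "x \<in> nz s" "?P w" for w s x
  proof -
    have "w s \<in> nz s" using that T by (auto simp: NZ_def)
    then have "same_rows (F w) (F (w(s := x)))"
      using left[OF that(2,1)] that(3) unfolding left_at_def by (metis fun_upd_triv)
    then show ?thesis using that NZ_nonzero same_rows_trans by metis
  qed
  moreover have "?P z" using minors by (simp add: same_rows_def)
  ultimately show ?thesis using NZ_override_induct[where P = ?P, OF z z' T] by blast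
qed

lemma same_cols_override:
  assumes z: "z \<in> NZ" and z': "z' \<in> NZ" and T: "T \<subseteq> S" and right: "\<And>s z. s \<in> T \<Longrightarrow> z \<in> NZ \<Longrightarrow> right_at s z"
  shows "same_cols (F z) (F (override_on z z' T))"
proof -
  let ?P = "\<lambda>w. same_cols (F z) (F w)"
  have "?P (w(s := x))" if "w \<in> NZ" "s \<in> T" "x \<in> nz s" "?P w" for w s x
  proof -
    have "w s \<in> nz s" using that T by (auto simp: NZ_def)
    then have "same_cols (F w) (F (w(s := x)))"
      using right[OF that(2,1)] that(3) unfolding right_at_def by (metis fun_upd_triv)
    then show ?thesis using that NZ_nonzero same_cols_trans by metis
  qed
  moreover have "?P z" using minors by (simp add: same_cols_def mult.commute)
  ultimately show ?thesis using NZ_override_induct[where P = ?P, OF z z' T] by blast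
qed

text \<open>Two linear maps, the second injective, whose values are always parallel are proportional; this
  is applied to the columns of \<open>F (z(s := x))\<close> and \<open>F (z0(s := x))\<close> as functions of \<open>x\<close>.\<close>

lemma scalar_upd:
  assumes s: "s \<in> S" and x: "x \<in> nz s" and y: "y \<in> nz s"
    and cols: "\<And>x. x \<in> nz s \<Longrightarrow> same_cols (F (z(s := x))) (F (z0(s := x)))"
    and rows: "same_rows (F (z(s := x))) (F (z(s := y)))"
    and col0: "\<And>x. x \<in> nz s \<Longrightarrow> \<exists>p. F (z0(s := x)) p q0 \<noteq> 0"
    and h: "h q1 \<noteq> 0"
    and Fx: "\<And>p q. F (z(s := x)) p q = F (z0(s := x)) p q0 * h q"
  shows "F (z(s := y)) p q = F (z0(s := y)) p q0 * h q"
proof -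
  define v where "v x p = F (z0(s := x)) p q0" for x p
  define w where "w x p = F (z(s := x)) p q1" for x p
  have v_lin: "v (\<lambda>t. a * x t + b * y t) p = a * v x p + b * v y p"
    and w_lin: "w (\<lambda>t. a * x t + b * y t) p = a * w x p + b * w y p" for a b p
    using linear[OF s] by (simp_all add: v_def w_def)
  have vw: "\<exists>k. \<forall>p. w x p = k * v x p" for x
  proof (cases "x \<in> nz s")
    case True
    then obtain p' where p': "v x p' \<noteq> 0" using col0 by (auto simp: v_def)
    have "w x p * v x p' = w x p' * v x p" for p
      using cols[OF True] by (simp add: same_cols_def v_def w_def)
    then have "w x p = w x p' / v x p' * v x p" for p using p' by (simp add: field_simps)
    then show ?thesis by blast
  next
    case False
    then show ?thesis using not_nz_zero[OF s False] by (simp add: w_def)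
  qed
  obtain k where k: "\<And>p. w y p = k * v y p" using vw by blast
  obtain l where l: "\<And>p. w (\<lambda>t. 1 * x t + 1 * y t) p = l * v (\<lambda>t. 1 * x t + 1 * y t) p"
    using vw by blast
  have wx: "w x p = h q1 * v x p" for p by (simp add: w_def v_def Fx)
  have eq: "(l - h q1) * v x p + (l - k) * v y p = 0" for p
    using l[of p] unfolding v_lin w_lin wx k by (simp add: algebra_simps)
  obtain px where px: "v x px \<noteq> 0" using col0[OF x] by (auto simp: v_def)
  obtain py where py: "v y py \<noteq> 0" using col0[OF y] by (auto simp: v_def)
  \<comment> \<open>The factors of proportionality at \<open>x\<close>, \<open>y\<close> and
    \<open>x + y\<close> are \<open>h q1\<close>, \<open>k\<close> and \<open>l\<close>. If
    \<open>l = k\<close>, then \<open>eq\<close> at an entry where \<open>v x\<close> is nonzero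
    settles the claim. Otherwise \<open>v y\<close> is a multiple \<open>c\<close> of
    \<open>v x\<close>; then \<open>y - c x\<close> is killed by \<open>v\<close>, hence is zero as
    a vector and is killed by \<open>w\<close> too, which again forces equal factors.\<close>
  have "k = h q1"
  proof (cases "l = k")
    case True
    then show ?thesis using eq[of px] px by simp
  next
    case False
    define c where "c = - (l - h q1) / (l - k)"
    have "v y p = c * v x p" for p using eq[of p] False by (simp add: c_def field_simps)
    then have vy: "v (\<lambda>t. - c * x t + 1 * y t) p = 0" for p unfolding v_lin by simp
    then have "(\<lambda>t. - c * x t + 1 * y t) \<notin> nz s" using col0 by (force simp: v_def)
    then have "w (\<lambda>t. - c * x t + 1 * y t) py = 0"
      using not_nz_zero[OF s] by (simp add: w_def)
    then have "w y py = c * w x py" unfolding w_lin by simp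
    moreover have "v y py = c * v x py" using vy[of py] unfolding v_lin by simp
    ultimately show ?thesis using py k[of py] wx[of py] by simp
  qed
  then have wy: "w y p = h q1 * v y p" using k by simp
  \<comment> \<open>Column \<open>q1\<close> is settled; the common row space of the values at
    \<open>x\<close> and \<open>y\<close> carries the result to every column.\<close>
  have "F (z(s := x)) px q1 * F (z(s := y)) p q = F (z(s := x)) px q * F (z(s := y)) p q1"
    using rows by (simp add: same_rows_def)
  then have "v x px * h q1 * F (z(s := y)) p q = v x px * h q * (h q1 * v y p)"
    using wy by (simp add: Fx v_def w_def)
  then show ?thesis using px h by (simp add: v_def mult.commute)
qed

section \<open>The global factorization\<close>

theorem factorization:
  "\<exists>L f g. L \<subseteq> S \<and> (\<forall>z p q. F z p q = f z p * g z q) \<and>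
    (\<forall>z z'. (\<forall>s\<in>L. z s = z' s) \<longrightarrow> f z = f z') \<and>
    (\<forall>z z'. (\<forall>s\<in>S - L. z s = z' s) \<longrightarrow> g z = g z')"
proof -
  interpret T: rank_one_multilinear S d "\<lambda>z q p. F z p q" by (rule transpose)
  \<comment> \<open>A base point; all that matters is that none of its slots is zero.\<close>
  define a :: "'s \<Rightarrow> nat \<Rightarrow> complex" where "a s t = 1" for s t
  have "a s \<in> nz s" if "s \<in> S" for s
    using dim[OF that] by (auto simp: nz_def a_def intro!: exI[of _ 0])
  then have a: "a \<in> NZ" by (simp add: NZ_def)
  define L where "L = {s \<in> S. left_at s a}"
  define R where "R = S - L"
  have LS: "L \<subseteq> S" and RS: "R \<subseteq> S" by (auto simp: L_def R_def)
  have left: "left_at s z" if "s \<in> L" "z \<in> NZ" for s z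
    using left_at_const[of s a z] a that by (auto simp: L_def)
  have right: "right_at s z" if "s \<in> R" "z \<in> NZ" for s z
    using left_at_const[of s z a] left_or_right[of s z] a that by (auto simp: L_def R_def)
  obtain p0 q0 where pq0: "F a p0 q0 \<noteq> 0" using NZ_nonzero[OF a] by blast
  \<comment> \<open>\<open>zL\<close> keeps the left slots of \<open>z\<close> and resets the right
    ones to \<open>a\<close>; \<open>zR\<close> does the opposite. Each also has a mirror form, an
    override on \<open>L\<close>, which differs from it only outside \<open>S\<close>.\<close>
  define zL where "zL z = override_on z a R" for z
  define zR where "zR z = override_on a z R" for z
  have NZL: "zL z \<in> NZ" and NZR: "zR z \<in> NZ" if "z \<in> NZ" for z
    using that a by (auto simp: NZ_def zL_def zR_def override_on_def)
  have zL_L: "F (zL z) = F (override_on a z L)" and zR_L: "F (zR z) = F (override_on z a L)" for z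
    by (rule cong; auto simp: zL_def zR_def override_on_def R_def)+
  have rowsR: "same_rows (F z) (F (zR z))" if "z \<in> NZ" for z
    unfolding zR_L using same_rows_override[OF that a LS] left by blast
  have colsL: "same_cols (F z) (F (zL z))" if "z \<in> NZ" for z
    unfolding zL_def using same_cols_override[OF that a RS] right by blast
  have rowsL: "same_rows (F a) (F (zL z))" if "z \<in> NZ" for z
    unfolding zL_L using same_rows_override[OF a that LS] left by blast
  have colsR: "same_cols (F a) (F (zR z))" if "z \<in> NZ" for z
    unfolding zR_def using same_cols_override[OF a that RS] right by blast
  \<comment> \<open>The row space of \<open>F (zL z)\<close> is that of \<open>F a\<close>, which
    does not vanish at \<open>q0\<close>; so a zero column \<open>q0\<close> would make the whole
    matrix zero.\<close>
  have col0: "\<exists>p. F (zL z) p q0 \<noteq> 0" if z: "z \<in> NZ" for z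
  proof (rule ccontr)
    assume "\<nexists>p. F (zL z) p q0 \<noteq> 0"
    moreover have "F a p0 q0 * F (zL z) p q = F a p0 q * F (zL z) p q0" for p q
      using rowsL[OF z] by (simp add: same_rows_def)
    ultimately show False using NZ_nonzero[OF NZL[OF z]] pq0 by auto
  qed
  have row0: "\<exists>q. F (zR z) p0 q \<noteq> 0" if z: "z \<in> NZ" for z
  proof (rule ccontr)
    assume "\<nexists>q. F (zR z) p0 q \<noteq> 0"
    moreover have "F a p0 q0 * F (zR z) p q = F a p q0 * F (zR z) p0 q" for p q
      using colsR[OF z] by (simp add: same_cols_def)
    ultimately show False using NZ_nonzero[OF NZR[OF z]] pq0 by auto
  qed
  \<comment> \<open>Column \<open>q0\<close> and row \<open>p0\<close> of the reset values; dividing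
    by \<open>F a p0 q0\<close> makes the two sides agree at \<open>a\<close>.\<close>
  define f where "f z p = F (zL z) p q0" for z p
  define g where "g z q = F (zR z) p0 q / F a p0 q0" for z q
  define P where "P z \<longleftrightarrow> (\<forall>p q. F z p q = f z p * g z q)" for z
  have zL_upd: "zL (z(s := x)) = (zL z)(s := x)" "zR (z(s := x)) = zR z" if "s \<in> L" for z s x
    using that by (auto simp: zL_def zR_def override_on_def R_def)
  have zR_upd: "zR (z(s := x)) = (zR z)(s := x)" "zL (z(s := x)) = zL z" if "s \<in> R" for z s x
    using that by (auto simp: zL_def zR_def override_on_def R_def)
  \<comment> \<open>A change in a left slot moves \<open>f\<close> and leaves \<open>g\<close>
    alone, and \<open>scalar_upd\<close> keeps the scalar fixed. A right slot is the same situation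
    after transposition.\<close>
  have step: "P (z(s := x))" if z: "z \<in> NZ" and s: "s \<in> S" and x: "x \<in> nz s" and Pz: "P z" for z s x
  proof (cases "s \<in> L")
    case True
    have zs: "z s \<in> nz s" using z s by (simp add: NZ_def)
    obtain q1 where q1: "g z q1 \<noteq> 0" using row0[OF z] pq0 by (auto simp: g_def)
    have "F (z(s := x)) p q = F ((zL z)(s := x)) p q0 * g z q" for p q
    proof (rule scalar_upd[OF s zs x, where z = z])
      show "same_cols (F (z(s := y))) (F ((zL z)(s := y)))" if "y \<in> nz s" for y
        using colsL[OF NZ_upd[OF z that]] zL_upd[OF True] by simp
      show "\<exists>p. F ((zL z)(s := y)) p q0 \<noteq> 0" if "y \<in> nz s" for y
        using col0[OF NZ_upd[OF z that]] zL_upd[OF True] by simp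
      show "same_rows (F (z(s := z s))) (F (z(s := x)))"
        using left[OF True z] zs x unfolding left_at_def by blast
      show "F (z(s := z s)) p q = F ((zL z)(s := z s)) p q0 * g z q" for p q
        using Pz zL_upd[OF True, of z "z s"] by (simp add: P_def f_def)
    qed (rule q1)
    then show ?thesis unfolding P_def f_def g_def zL_upd[OF True] by blast
  next
    case False
    then have sR: "s \<in> R" using s by (simp add: R_def)
    have zs: "z s \<in> nz s" using z s by (simp add: NZ_def)
    obtain p1 where p1: "f z p1 / F a p0 q0 \<noteq> 0" using col0[OF z] pq0 by (auto simp: f_def)
    have "F (z(s := x)) p q = F ((zR z)(s := x)) p0 q * (f z p / F a p0 q0)" for p q
    proof (rule T.scalar_upd[OF s zs x, where z = z])
      show "same_cols (\<lambda>q p. F (z(s := y)) p q) (\<lambda>q p. F ((zR z)(s := y)) p q)" if "y \<in> nz s" for y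
        using rowsR[OF NZ_upd[OF z that]] zR_upd[OF sR] by (simp add: same_cols_transpose)
      show "\<exists>q. F ((zR z)(s := y)) p0 q \<noteq> 0" if "y \<in> nz s" for y
        using row0[OF NZ_upd[OF z that]] zR_upd[OF sR] by simp
      show "same_rows (\<lambda>q p. F (z(s := z s)) p q) (\<lambda>q p. F (z(s := x)) p q)"
        using right[OF sR z] zs x unfolding right_at_def same_cols_transpose by blast
      show "F (z(s := z s)) p q = F ((zR z)(s := z s)) p0 q * (f z p / F a p0 q0)" for p q
        using Pz zR_upd[OF sR, of z "z s"] by (simp add: P_def g_def)
    qed (rule p1)
    then show ?thesis unfolding P_def f_def g_def zR_upd[OF sR] by simp
  qed
  have "P a"
  proof -
    have "zL a = a" "zR a = a" by (auto simp: zL_def zR_def override_on_def)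
    then show ?thesis using minors[of a _ _ p0 q0] pq0
      by (simp add: P_def f_def g_def field_simps)
  qed
  have P: "P z" for z
  proof (cases "z \<in> NZ")
    case True
    have "P (override_on a z S)"
      using NZ_override_induct[where P = P and T = S, OF a True _ \<open>P a\<close>] step by blast
    moreover have "F (override_on a z S) = F z" "F (zL (override_on a z S)) = F (zL z)"
      "F (zR (override_on a z S)) = F (zR z)"
      by (rule cong; auto simp: zL_def zR_def override_on_def R_def)+
    ultimately show ?thesis by (simp add: P_def f_def g_def)
  next
    case False
    then obtain s where s: "s \<in> S" "z s \<notin> nz s" by (auto simp: NZ_def)
    \<comment> \<open>The zero slot survives in \<open>zR z\<close> or in \<open>zL z\<close>
      according to its kind, so one of the two factors vanishes.\<close>
    have "f z p * g z q = 0" for p q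
    proof (cases "s \<in> R")
      case True
      then have "zR z \<notin> NZ" using s by (auto simp: NZ_def zR_def override_on_def)
      then show ?thesis using not_NZ_zero by (simp add: g_def)
    next
      case False
      then have "zL z \<notin> NZ" using s by (auto simp: NZ_def zL_def override_on_def)
      then show ?thesis using not_NZ_zero by (simp add: f_def)
    qed
    then show ?thesis using not_NZ_zero[OF False] by (simp add: P_def)
  qed
  have f_cong: "f z = f z'" if "\<forall>s\<in>L. z s = z' s" for z z'
  proof -
    have "F (zL z) = F (zL z')"
      by (rule cong) (use that in \<open>auto simp: zL_def override_on_def R_def\<close>)
    then show ?thesis by (intro ext) (simp add: f_def)
  qed
  have g_cong: "g z = g z'" if "\<forall>s\<in>S - L. z s = z' s" for z z'
  proof -
    have "zR z = zR z'" using that by (auto simp: zR_def override_on_def R_def)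
    then show ?thesis by (intro ext) (simp add: g_def)
  qed
  show ?thesis
    by (intro exI[of _ L] exI[of _ f] exI[of _ g]) (use LS P f_cong g_cong in \<open>simp add: P_def\<close>)
qed

end

section \<open>Rank and independent columns\<close>

text \<open>Passes from sets of column vectors to column indices: \<open>e\<close> picks one index
  for each vector of a maximal independent set of columns, so repeated columns do no harm.\<close>

lemma (in vec_space) rank_column_basis:
  assumes A: "A \<in> carrier_mat n nc"
  obtains J V where "J \<subseteq> {..<nc}" and "card J = rank A"
    and "\<And>i j. i < n \<Longrightarrow> j < nc \<Longrightarrow> A $$ (i, j) = (\<Sum>l\<in>J. A $$ (i, l) * V l j)"
    and "\<And>c l. (\<And>i. i < n \<Longrightarrow> (\<Sum>l\<in>J. A $$ (i, l) * c l) = 0) \<Longrightarrow> l \<in> J \<Longrightarrow> c l = 0"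
proof -
  let ?P = "\<lambda>T. T \<subseteq> set (cols A) \<and> lin_indpt T"
  have cols: "set (cols A) \<subseteq> carrier_vec n" using cols_dim A by blast
  have "lin_indpt {}" by (simp add: lin_dep_def)
  then obtain S where S: "maximal S ?P"
    using maximal_exists_superset[of "set (cols A)" ?P "{}"] by auto
  then have SA: "S \<subseteq> set (cols A)" and Si: "lin_indpt S" by (auto simp: maximal_def)
  have fS: "finite S" using SA finite_subset by blast
  have Sn: "S \<subseteq> carrier_vec n" using SA cols by blast
  have "\<exists>j. j < nc \<and> col A j = w" if "w \<in> S" for w
  proof -
    have "w \<in> set (cols A)" using that SA by blast
    then show ?thesis using A by (auto simp: cols_def)
  qed
  then obtain e where e: "\<And>w. w \<in> S \<Longrightarrow> e w < nc" "\<And>w. w \<in> S \<Longrightarrow> col A (e w) = w"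
    by metis
  have inj: "inj_on e S" using e(2) by (metis inj_onI)
  have ix: "A $$ (i, e w) = w $ i" if "w \<in> S" "i < n" for i w
  proof -
    have "A $$ (i, e w) = col A (e w) $ i" using that e(1) A by simp
    then show ?thesis using e(2) that by simp
  qed
  have sum_e: "(\<Sum>l\<in>e ` S. A $$ (i, l) * c l) = lincomb (\<lambda>w. c (e w)) S $ i" if "i < n" for i c
    unfolding lincomb_index[OF that Sn]
    by (subst sum.reindex[OF inj]) (auto intro!: sum.cong simp: ix that mult.commute)
  have span: "col A j \<in> span S" if "j < nc" for j
  proof (rule ccontr)
    assume not: "col A j \<notin> span S"
    have cj: "col A j \<in> set (cols A)" using that A by (simp add: cols_def)
    then have cjn: "col A j \<in> carrier_vec n" using cols by blast
    have nS: "col A j \<notin> S" using not Sn span_mem by auto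
    then have "lin_indpt (S \<union> {col A j})"
      using lin_dep_iff_in_span[of S "col A j"] not Sn Si cjn by simp
    then have "?P (S \<union> {col A j})" using SA cj by simp
    then show False using S nS unfolding maximal_def by blast
  qed
  have "\<exists>a. lincomb a S = col A j" if "j < nc" for j
    using finite_in_span[OF fS _ span[OF that]] Sn by auto
  then obtain a where a: "\<And>j. j < nc \<Longrightarrow> lincomb (a j) S = col A j" by metis
  show thesis
  proof
    show "e ` S \<subseteq> {..<nc}" using e(1) by auto
    show "card (e ` S) = rank A" using rank_card_indpt[OF A S] card_image[OF inj] by simp
    show "A $$ (i, j) = (\<Sum>l\<in>e ` S. A $$ (i, l) * a j (inv_into S e l))" if "i < n" "j < nc" for i j
    proof -
      have "lincomb (\<lambda>w. a j (inv_into S e (e w))) S = lincomb (a j) S"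
        using Sn inj by (intro lincomb_cong) auto
      then show ?thesis unfolding sum_e[OF that(1)] using a[OF that(2)] that A by simp
    qed
    show "c l = 0" if *: "\<And>i. i < n \<Longrightarrow> (\<Sum>l\<in>e ` S. A $$ (i, l) * c l) = 0" and "l \<in> e ` S" for c l
    proof -
      have "lincomb (\<lambda>w. c (e w)) S = 0\<^sub>v n"
        using *[unfolded sum_e] lincomb_dim[OF fS Sn] by (intro eq_vecI) (simp_all add: sum_e)
      then have "c (e w) = 0" if "w \<in> S" for w
        using lin_dep_crit[where A = S and S = S and a = "\<lambda>w. c (e w)" and v = w] fS Si that by auto
      then show ?thesis using \<open>l \<in> e ` S\<close> by blast
    qed
  qed
qed

text \<open>Independence as an indexed family: equal columns at two indices of \<open>J\<close>
  count as dependent, unlike for the set of these columns.\<close>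

definition indep_cols :: "'a :: field mat \<Rightarrow> nat set \<Rightarrow> bool" where
  "indep_cols A J \<longleftrightarrow> J \<subseteq> {..<dim_col A} \<and>
     (\<forall>c. (\<forall>i<dim_row A. (\<Sum>l\<in>J. A $$ (i, l) * c l) = 0) \<longrightarrow> (\<forall>l\<in>J. c l = 0))"

lemma indep_colsD:
  assumes "indep_cols A J" and "\<And>i. i < dim_row A \<Longrightarrow> (\<Sum>l\<in>J. A $$ (i, l) * c l) = 0" and "l \<in> J"
  shows "c l = 0"
  using assms unfolding indep_cols_def by blast

lemma rank_factorization:
  fixes A :: "'a :: field mat"
  obtains J V where "indep_cols A J" and "card J = mat_rank A"
    and "\<And>i j. i < dim_row A \<Longrightarrow> j < dim_col A \<Longrightarrow> A $$ (i, j) = (\<Sum>l\<in>J. A $$ (i, l) * V l j)"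
proof -
  interpret vec_space "TYPE('a)" "dim_row A" .
  show thesis
  proof (rule rank_column_basis[of A "dim_col A"])
    fix J V
    assume J: "J \<subseteq> {..<dim_col A}" "card J = rank A"
      and span: "\<And>i j. i < dim_row A \<Longrightarrow> j < dim_col A \<Longrightarrow> A $$ (i, j) = (\<Sum>l\<in>J. A $$ (i, l) * V l j)"
      and indep: "\<And>c l. (\<And>i. i < dim_row A \<Longrightarrow> (\<Sum>l\<in>J. A $$ (i, l) * c l) = 0) \<Longrightarrow> l \<in> J \<Longrightarrow> c l = 0"
    have "indep_cols A J" unfolding indep_cols_def using J(1) indep by blast
    then show thesis using J(2) span by (rule that)
  qed simp
qed

lemma indep_cols_rank:
  fixes A :: "'a :: field mat"
  assumes J: "indep_cols A J" shows "card J \<le> mat_rank A"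
proof -
  interpret vec_space "TYPE('a)" "dim_row A" .
  have A: "A \<in> carrier_mat (dim_row A) (dim_col A)" by simp
  have JA: "J \<subseteq> {..<dim_col A}" using J by (simp add: indep_cols_def)
  then have fJ: "finite J" using finite_subset by blast
  have cols: "set (cols A) \<subseteq> carrier_vec (dim_row A)" using cols_dim A by blast
  have sub: "col A ` J \<subseteq> set (cols A)" using JA by (auto simp: cols_def)
  have carr: "col A ` J \<subseteq> carrier_vec (dim_row A)" using sub cols by blast
  have inj: "inj_on (col A) J"
  proof (rule inj_onI, rule ccontr)
    fix k l assume kl: "k \<in> J" "l \<in> J" "col A k = col A l" "k \<noteq> l"
    \<comment> \<open>The difference of two indicator functions: equal columns at \<open>k\<close>
      and \<open>l\<close> would give a nontrivial relation.\<close>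
    define c where "c = (\<lambda>j. (if j = k then 1 else 0) - (if j = l then 1 else 0 :: 'a))"
    have "A $$ (i, k) = A $$ (i, l)" if "i < dim_row A" for i
    proof -
      have "col A k $ i = A $$ (i, k)" "col A l $ i = A $$ (i, l)"
        by (rule index_col; use kl(1,2) JA that in auto)+
      then show ?thesis using kl(3) by simp
    qed
    then have "(\<Sum>j\<in>J. A $$ (i, j) * c j) = 0" if "i < dim_row A" for i
      using that kl fJ
      by (simp add: c_def right_diff_distrib sum_subtractf if_distrib[of "(*) _"] cong: if_cong)
    then have "c k = 0" using indep_colsD[OF J _ kl(1)] by blast
    then show False using kl(4) by (simp add: c_def)
  qed
  have "lin_indpt (col A ` J)"
  proof
    assume "lin_dep (col A ` J)"
    then obtain a v where av: "lincomb a (col A ` J) = 0\<^sub>v (dim_row A)" "v \<in> col A ` J" "a v \<noteq> 0"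
      using finite_lin_dep[of "col A ` J"] fJ carr by auto
    have "(\<Sum>j\<in>J. A $$ (i, j) * a (col A j)) = 0" if "i < dim_row A" for i
    proof -
      have "(\<Sum>j\<in>J. A $$ (i, j) * a (col A j)) = (\<Sum>w\<in>col A ` J. a w * w $ i)"
        using that JA by (subst sum.reindex[OF inj]) (auto intro!: sum.cong simp: mult.commute)
      also have "\<dots> = lincomb a (col A ` J) $ i"
        using that sub cols by (subst lincomb_index) auto
      finally show ?thesis using av(1) that by simp
    qed
    then have "a (col A j) = 0" if "j \<in> J" for j using indep_colsD[OF J, where c = "\<lambda>j. a (col A j)"] that by blast
    then show False using av by auto
  qed
  then show ?thesis using rank_ge_card_indpt[OF A sub] card_image[OF inj] by simp
qed

lemma rank_le_outer_sum:
  fixes A :: "'a :: field mat"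
  assumes A: "A \<in> carrier_mat nr nc" and T: "finite T"
    and sum: "\<And>i j. i < nr \<Longrightarrow> j < nc \<Longrightarrow> A $$ (i, j) = (\<Sum>t\<in>T. u t i * v t j)"
  shows "mat_rank A \<le> card T"
proof -
  interpret vec_space "TYPE('a)" nr .
  have "rank (mat nr nc (\<lambda>(i, j). \<Sum>t\<in>T. u t i * v t j)) \<le> card T"
    using T
  proof (induction T)
    case empty
    have "mat nr nc (\<lambda>(i, j). \<Sum>t\<in>{}. u t i * v t j) = 0\<^sub>m nr nc" by (auto intro!: eq_matI)
    then show ?case using rank_0I by (metis card.empty order_refl)
  next
    case (insert t T)
    let ?B = "mat nr nc (\<lambda>(i, j). u t i * v t j)"
    let ?C = "mat nr nc (\<lambda>(i, j). \<Sum>t\<in>T. u t i * v t j)"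
    have "mat nr nc (\<lambda>(i, j). \<Sum>t\<in>insert t T. u t i * v t j) = ?B + ?C"
      using insert by (auto intro!: eq_matI)
    moreover have "rank (?B + ?C) \<le> rank ?B + rank ?C" by (rule rank_subadditive) auto
    moreover have "rank ?B \<le> 1" by (rule rank_le_1_product_entries[of _ _ "u t" "v t"]) auto
    ultimately show ?case using insert by simp
  qed
  moreover have "A = mat nr nc (\<lambda>(i, j). \<Sum>t\<in>T. u t i * v t j)"
    using A sum by (auto intro!: eq_matI)
  ultimately show ?thesis using A by auto
qed

lemma rank_eq_1I:
  fixes A :: "'a :: field mat"
  assumes A: "A \<in> carrier_mat nr nc" and uv: "\<And>i j. i < nr \<Longrightarrow> j < nc \<Longrightarrow> A $$ (i, j) = u i * v j"
    and ij: "i < nr" "j < nc" "A $$ (i, j) \<noteq> 0"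
  shows "mat_rank A = 1"
proof -
  have "mat_rank A \<le> card {()}"
    by (rule rank_le_outer_sum[OF A, of _ "\<lambda>_. u" "\<lambda>_. v"]) (auto simp: uv)
  moreover have "indep_cols A {j}" using A ij by (auto simp: indep_cols_def)
  then have "1 \<le> mat_rank A" using indep_cols_rank by fastforce
  ultimately show ?thesis by simp
qed

lemma rank_1_minors:
  fixes A :: "'a :: field mat"
  assumes A: "A \<in> carrier_mat nr nc" and 1: "mat_rank A = 1"
    and i: "i < nr" "i' < nr" "j < nc" "j' < nc"
  shows "A $$ (i, j) * A $$ (i', j') = A $$ (i, j') * A $$ (i', j)"
proof -
  obtain J V where J: "card J = 1"
    "\<And>i j. i < nr \<Longrightarrow> j < nc \<Longrightarrow> A $$ (i, j) = (\<Sum>l\<in>J. A $$ (i, l) * V l j)"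
    using rank_factorization[of A] A 1 by (metis carrier_matD)
  then obtain l where "J = {l}" by (auto simp: card_1_singleton_iff)
  then have *: "A $$ (i, j) = A $$ (i, l) * V l j" if "i < nr" "j < nc" for i j using J that by simp
  show ?thesis unfolding *[OF i(1,3)] *[OF i(2,4)] *[OF i(1,4)] *[OF i(2,3)] by (simp add: mult_ac)
qed

lemma rank_1_nonzero:
  fixes A :: "'a :: field mat"
  assumes A: "A \<in> carrier_mat nr nc" and 1: "mat_rank A = 1"
  obtains i j where "i < nr" "j < nc" "A $$ (i, j) \<noteq> 0"
proof (rule ccontr)
  assume "\<not> thesis"
  then have "A = 0\<^sub>m nr nc" using A that by (intro eq_matI) auto
  then show False using 1 by (simp add: vec_space.rank_0I)
qed

section \<open>Entries and ranks of Kronecker products\<close>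

text \<open>Mixed radix digits with radix \<open>n i\<close> at position \<open>i\<close>, the last
  position being the least significant. They turn a row or column index of a Kronecker product into
  its multi-index.\<close>

primrec digits :: "(nat \<Rightarrow> nat) \<Rightarrow> nat \<Rightarrow> nat \<Rightarrow> nat \<Rightarrow> nat" where
  "digits n 0 p = (\<lambda>_. 0)"
| "digits n (Suc k) p = (digits n k (p div n (Suc k)))(Suc k := p mod n (Suc k))"

lemma digits_less:
  assumes "p < (\<Prod>i=1..k. n i)" and "i \<in> {1..k}"
  shows "digits n k p i < n i"
  using assms
proof (induction k arbitrary: p)
  case (Suc k)
  have p: "p < (\<Prod>i=1..k. n i) * n (Suc k)" using Suc.prems by simp
  then have "p div n (Suc k) < (\<Prod>i=1..k. n i)" by (rule less_mult_imp_div_less)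
  moreover have "n (Suc k) > 0" using p by (cases "n (Suc k)") auto
  ultimately show ?case using Suc by (cases "i = Suc k") auto
qed simp

lemma digits_inj:
  assumes "p < (\<Prod>i=1..k. n i)" and "q < (\<Prod>i=1..k. n i)"
    and "\<And>i. i \<in> {1..k} \<Longrightarrow> digits n k p i = digits n k q i"
  shows "p = q"
  using assms
proof (induction k arbitrary: p q)
  case (Suc k)
  have "p div n (Suc k) = q div n (Suc k)"
  proof (rule Suc.IH)
    show "p div n (Suc k) < (\<Prod>i=1..k. n i)" "q div n (Suc k) < (\<Prod>i=1..k. n i)"
      using Suc.prems by (auto intro!: less_mult_imp_div_less)
    show "digits n k (p div n (Suc k)) i = digits n k (q div n (Suc k)) i" if "i \<in> {1..k}" for i
      using Suc.prems(3)[of i] that by simp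
  qed
  moreover have "p mod n (Suc k) = q mod n (Suc k)" using Suc.prems(3)[of "Suc k"] by simp
  ultimately show ?case by (metis div_mult_mod_eq)
qed simp

text \<open>Digits determine the number, and both sides have the same finite cardinality, so no
  inverse has to be written down.\<close>

lemma bij_betw_digits:
  "bij_betw (\<lambda>p. restrict (digits n k p) {1..k}) {..<\<Prod>i=1..k. n i} (\<Pi>\<^sub>E i\<in>{1..k}. {..<n i})"
proof -
  let ?h = "\<lambda>p. restrict (digits n k p) {1..k}" and ?m = "\<Prod>i=1..k. n i"
  have inj: "inj_on ?h {..<?m}"
  proof (rule inj_onI)
    fix p q assume "p \<in> {..<?m}" "q \<in> {..<?m}" "?h p = ?h q"
    moreover from this(3) have "digits n k p i = digits n k q i" if "i \<in> {1..k}" for i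
      using that by (metis restrict_apply')
    ultimately show "p = q" by (intro digits_inj[of p n k q]) auto
  qed
  have sub: "?h ` {..<?m} \<subseteq> (\<Pi>\<^sub>E i\<in>{1..k}. {..<n i})" using digits_less by fastforce
  have "card (?h ` {..<?m}) = card (\<Pi>\<^sub>E i\<in>{1..k}. {..<n i})"
    using card_image[OF inj] by (simp add: card_PiE)
  then have "?h ` {..<?m} = (\<Pi>\<^sub>E i\<in>{1..k}. {..<n i})"
    using sub by (intro card_subset_eq finite_PiE) auto
  with inj show ?thesis by (simp add: bij_betw_def)
qed

lemma kron_mats_index:
  assumes "\<And>i. i \<in> {1..k} \<Longrightarrow> A i \<in> carrier_mat (n i) (n i)"
    and "p < (\<Prod>i=1..k. n i)" and "q < (\<Prod>i=1..k. n i)"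
  shows "kron_mats k A $$ (p, q) = (\<Prod>i=1..k. A i $$ (digits n k p i, digits n k q i))"
  using assms
proof (induction k arbitrary: p q)
  case (Suc k)
  have K: "kron_mats k A \<in> carrier_mat (\<Prod>i=1..k. n i) (\<Prod>i=1..k. n i)"
    using Suc.prems by (intro kron_mats_carrier) auto
  have A: "A (Suc k) \<in> carrier_mat (n (Suc k)) (n (Suc k))" using Suc.prems by auto
  have "kron_mats (Suc k) A $$ (p, q) = kron_mats k A $$ (p div n (Suc k), q div n (Suc k)) *
      A (Suc k) $$ (p mod n (Suc k), q mod n (Suc k))"
    using Suc.prems(2,3) by (simp add: kron_mat_def carrier_matD[OF A] carrier_matD[OF K])
  also have "kron_mats k A $$ (p div n (Suc k), q div n (Suc k)) =
      (\<Prod>i=1..k. A i $$ (digits n (Suc k) p i, digits n (Suc k) q i))"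
    using Suc.prems by (subst Suc.IH) (auto intro!: less_mult_imp_div_less prod.cong)
  finally show ?case by simp
qed simp

lemma kron_vecs_index:
  assumes "\<And>i. i \<in> {1..k} \<Longrightarrow> x i \<in> carrier_vec (n i)" and "p < (\<Prod>i=1..k. n i)"
  shows "kron_vecs k x $ p = (\<Prod>i=1..k. x i $ digits n k p i)"
  using assms
proof (induction k arbitrary: p)
  case (Suc k)
  have K: "kron_vecs k x \<in> carrier_vec (\<Prod>i=1..k. n i)"
    using Suc.prems by (intro kron_vecs_carrier) auto
  have x: "x (Suc k) \<in> carrier_vec (n (Suc k))" using Suc.prems by auto
  have "kron_vecs (Suc k) x $ p = kron_vecs k x $ (p div n (Suc k)) * x (Suc k) $ (p mod n (Suc k))"
    using Suc.prems(2) by (simp add: kron_vec_def carrier_vecD[OF x] carrier_vecD[OF K])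
  also have "kron_vecs k x $ (p div n (Suc k)) = (\<Prod>i=1..k. x i $ digits n (Suc k) p i)"
    using Suc.prems by (subst Suc.IH) (auto intro!: less_mult_imp_div_less prod.cong)
  finally show ?case by simp
qed (simp add: unit_vec_def)

text \<open>The product of columns \<open>j\<close> and \<open>k\<close> has index
  \<open>j * dim_col B + k\<close>. In a relation among these columns, fix a row of
  \<open>B\<close>: the inner sums over \<open>K\<close> are the coefficients of a relation among
  the columns of \<open>A\<close>, so they vanish. What is left is a relation among the columns of
  \<open>B\<close>.\<close>

lemma indep_cols_kron:
  fixes A B :: "'a :: field mat"
  assumes J: "indep_cols A J" and K: "indep_cols B K"
  shows "\<exists>L. indep_cols (A \<otimes>\<^sub>m B) L \<and> card L = card J * card K"
proof (intro exI conjI)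
  let ?e = "\<lambda>(j, k). j * dim_col B + k"
  have JA: "J \<subseteq> {..<dim_col A}" and KB: "K \<subseteq> {..<dim_col B}" using J K by (auto simp: indep_cols_def)
  have dm: "?e (j, k) div dim_col B = j" "?e (j, k) mod dim_col B = k" if "k \<in> K" for j k
    using that KB by auto
  have inj: "inj_on ?e (J \<times> K)"
    by (rule inj_onI) (use dm in \<open>metis (no_types, lifting) SigmaE2 surj_pair\<close>)
  show "card (?e ` (J \<times> K)) = card J * card K"
    using card_image[OF inj] by (simp add: card_cartesian_product)
  have less: "j * dim_col B + k < dim_col A * dim_col B" if "j \<in> J" "k \<in> K" for j k
  proof -
    have "j * dim_col B + k < Suc j * dim_col B" using that KB by auto
    also have "\<dots> \<le> dim_col A * dim_col B" using that JA by (intro mult_right_mono) auto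
    finally show ?thesis .
  qed
  have "c (j * dim_col B + k) = 0"
    if *: "\<And>i. i < dim_row (A \<otimes>\<^sub>m B) \<Longrightarrow> (\<Sum>l\<in>?e ` (J \<times> K). (A \<otimes>\<^sub>m B) $$ (i, l) * c l) = 0"
      and j: "j \<in> J" and k: "k \<in> K" for c j k
  proof -
    have "(\<Sum>k\<in>K. B $$ (i2, k) * c (j * dim_col B + k)) = 0" if i2: "i2 < dim_row B" for i2
    proof (rule indep_colsD[OF J _ j, where c = "\<lambda>j. \<Sum>k\<in>K. B $$ (i2, k) * c (j * dim_col B + k)"])
      fix i1 assume i1: "i1 < dim_row A"
      have "i1 * dim_row B + i2 < Suc i1 * dim_row B" using i2 by simp
      also have "\<dots> \<le> dim_row A * dim_row B" using i1 by (intro mult_right_mono) auto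
      finally have i: "i1 * dim_row B + i2 < dim_row A * dim_row B" .
      have "(\<Sum>j\<in>J. A $$ (i1, j) * (\<Sum>k\<in>K. B $$ (i2, k) * c (j * dim_col B + k))) =
          (\<Sum>(j, k)\<in>J \<times> K. A $$ (i1, j) * B $$ (i2, k) * c (j * dim_col B + k))"
        by (simp add: sum.cartesian_product sum_distrib_left mult.assoc)
      also have "\<dots> = (\<Sum>l\<in>?e ` (J \<times> K). (A \<otimes>\<^sub>m B) $$ (i1 * dim_row B + i2, l) * c l)"
        unfolding sum.reindex[OF inj] o_def
      proof (rule sum.cong, safe)
        fix j k assume jk: "j \<in> J" "k \<in> K"
        show "A $$ (i1, j) * B $$ (i2, k) * c (j * dim_col B + k) =
            (A \<otimes>\<^sub>m B) $$ (i1 * dim_row B + i2, j * dim_col B + k) * c (j * dim_col B + k)"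
          using i less[OF jk] dm[OF jk(2), of j] i2 by (simp add: kron_mat_def)
      qed
      also have "\<dots> = 0" using i by (intro *) (simp add: kron_mat_def)
      finally show "(\<Sum>j\<in>J. A $$ (i1, j) * (\<Sum>k\<in>K. B $$ (i2, k) * c (j * dim_col B + k))) = 0" .
    qed
    then show ?thesis using indep_colsD[OF K _ k, where c = "\<lambda>k. c (j * dim_col B + k)"] by blast
  qed
  then show "indep_cols (A \<otimes>\<^sub>m B) (?e ` (J \<times> K))"
    using less unfolding indep_cols_def by (auto simp: kron_mat_def)
qed

lemma indep_cols_kron_mats:
  fixes A :: "nat \<Rightarrow> 'a :: field mat"
  assumes "\<And>i. i \<in> {1..k} \<Longrightarrow> indep_cols (A i) (J i)"
  shows "\<exists>L. indep_cols (kron_mats k A) L \<and> card L = (\<Prod>i=1..k. card (J i))"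
  using assms
proof (induction k)
  case 0
  show ?case by (intro exI[of _ "{0}"]) (auto simp: indep_cols_def)
next
  case (Suc k)
  then obtain L where L: "indep_cols (kron_mats k A) L" "card L = (\<Prod>i=1..k. card (J i))" by auto
  then show ?case using indep_cols_kron[OF L(1), of "A (Suc k)" "J (Suc k)"] Suc.prems by auto
qed

lemma linear_map_mat_sum:
  assumes lin: "linear_map_mat m \<phi>" and T: "finite T" and B: "B \<in> carrier_mat m m"
    and C: "\<And>t. t \<in> T \<Longrightarrow> C t \<in> carrier_mat m m"
    and BC: "\<And>p q. p < m \<Longrightarrow> q < m \<Longrightarrow> B $$ (p, q) = (\<Sum>t\<in>T. c t * C t $$ (p, q))"
    and ab: "a < m" "b < m"
  shows "\<phi> B $$ (a, b) = (\<Sum>t\<in>T. c t * \<phi> (C t) $$ (a, b))"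
proof -
  note lin' = lin[unfolded linear_map_mat_iff]
  have carr: "\<phi> A \<in> carrier_mat m m" if "A \<in> carrier_mat m m" for A using lin' that by auto
  have "\<phi> (mat m m (\<lambda>(p, q). \<Sum>t\<in>T. c t * C t $$ (p, q))) $$ (a, b) =
      (\<Sum>t\<in>T. c t * \<phi> (C t) $$ (a, b))"
    using T C
  proof (induction T)
    case empty
    have "\<phi> (0 \<cdot>\<^sub>m 0\<^sub>m m m) = 0 \<cdot>\<^sub>m \<phi> (0\<^sub>m m m)" using lin' zero_carrier_mat by blast
    moreover have zero: "mat m m (\<lambda>(p, q). \<Sum>t\<in>{}. c t * C t $$ (p, q)) = 0\<^sub>m m m"
      by (rule eq_matI) auto
    moreover have "(0 \<cdot>\<^sub>m \<phi> (0\<^sub>m m m)) $$ (a, b) = 0" using carr[of "0\<^sub>m m m"] ab by simp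
    ultimately show ?case unfolding zero by simp
  next
    case (insert t T)
    let ?B = "mat m m (\<lambda>(p, q). \<Sum>t\<in>T. c t * C t $$ (p, q))"
    have Ct: "C t \<in> carrier_mat m m" using insert by auto
    have split: "mat m m (\<lambda>(p, q). \<Sum>t\<in>insert t T. c t * C t $$ (p, q)) = c t \<cdot>\<^sub>m C t + ?B"
      using insert by (intro eq_matI) (auto simp: carrier_matD[OF Ct])
    have add: "\<phi> (c t \<cdot>\<^sub>m C t + ?B) = c t \<cdot>\<^sub>m \<phi> (C t) + \<phi> ?B" using lin' Ct by simp
    have "\<phi> ?B $$ (a, b) = (\<Sum>t\<in>T. c t * \<phi> (C t) $$ (a, b))" using insert by blast
    then show ?case unfolding split add
      using insert(1,2) carrier_matD[OF carr[OF Ct]] carrier_matD[OF carr[of ?B]] ab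
      by simp
  qed
  moreover have "B = mat m m (\<lambda>(p, q). \<Sum>t\<in>T. c t * C t $$ (p, q))"
    using B BC by (intro eq_matI) auto
  ultimately show ?thesis by simp
qed

section \<open>Rank one preservers\<close>

lemma kron_mats_cong:
  assumes "\<And>i. i \<in> {1..k} \<Longrightarrow> A i = B i" shows "kron_mats k A = kron_mats k B"
  using assms by (induction k) auto

lemma digits_surj:
  assumes "\<And>i. i \<in> {1..k} \<Longrightarrow> P i < n i"
  obtains p where "p < (\<Prod>i=1..k. n i)" and "\<And>i. i \<in> {1..k} \<Longrightarrow> digits n k p i = P i"
proof -
  have "restrict P {1..k} \<in> (\<Pi>\<^sub>E i\<in>{1..k}. {..<n i})" using assms by auto
  then have "restrict P {1..k} \<in> (\<lambda>p. restrict (digits n k p) {1..k}) ` {..<\<Prod>i=1..k. n i}"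
    using bij_betw_digits[of n k] by (simp add: bij_betw_def)
  then obtain p where p: "p < (\<Prod>i=1..k. n i)" "restrict P {1..k} = restrict (digits n k p) {1..k}"
    by auto
  have "digits n k p i = P i" if "i \<in> {1..k}" for i using p(2) that by (metis restrict_apply')
  with p(1) show thesis by (rule that)
qed

definition unit_fun :: "nat \<Rightarrow> nat \<Rightarrow> complex" where
  "unit_fun s t = (if t = s then 1 else 0)"

locale rank_one_preserver =
  fixes k m :: nat and n :: "nat \<Rightarrow> nat" and \<phi> :: "complex mat \<Rightarrow> complex mat"
  assumes n: "\<And>i. i \<in> {1..k} \<Longrightarrow> n i \<ge> 2"
    and m: "m = (\<Prod>i=1..k. n i)"
    and lin: "linear_map_mat m \<phi>"
    and rank_one: "\<And>A. (\<And>i. i \<in> {1..k} \<Longrightarrow> A i \<in> carrier_mat (n i) (n i)) \<Longrightarrow>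
        mat_rank (kron_mats k A) = 1 \<Longrightarrow> mat_rank (\<phi> (kron_mats k A)) = 1"
begin

text \<open>Slot \<open>(i, False)\<close> holds the column vector and slot \<open>(i, True)\<close>
  the row vector of the outer product in factor \<open>i\<close>.\<close>

definition outers :: "(nat \<times> bool \<Rightarrow> nat \<Rightarrow> complex) \<Rightarrow> nat \<Rightarrow> complex mat" where
  "outers z i = mat (n i) (n i) (\<lambda>(p, q). z (i, False) p * z (i, True) q)"

text \<open>The value 0 outside the m x m range lets linearity and the minor identities hold for all
  indices.\<close>

definition F :: "(nat \<times> bool \<Rightarrow> nat \<Rightarrow> complex) \<Rightarrow> nat \<Rightarrow> nat \<Rightarrow> complex" where
  "F z a b = (if a < m \<and> b < m then \<phi> (kron_mats k (outers z)) $$ (a, b) else 0)"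

lemma outers_carrier: "outers z i \<in> carrier_mat (n i) (n i)"
  by (simp add: outers_def)

lemma kron_carrier:
  assumes "\<And>i. i \<in> {1..k} \<Longrightarrow> A i \<in> carrier_mat (n i) (n i)"
  shows "kron_mats k A \<in> carrier_mat m m"
  unfolding m using assms by (rule kron_mats_carrier)

lemma phi_carrier: "A \<in> carrier_mat m m \<Longrightarrow> \<phi> A \<in> carrier_mat m m"
  using lin unfolding linear_map_mat_iff by auto

lemma kron_outers_carrier: "kron_mats k (outers z) \<in> carrier_mat m m"
  by (rule kron_carrier[OF outers_carrier])

lemma kron_outers_index:
  assumes "p < m" "q < m"
  shows "kron_mats k (outers z) $$ (p, q) =
    (\<Prod>i=1..k. z (i, False) (digits n k p i)) * (\<Prod>i=1..k. z (i, True) (digits n k q i))"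
proof -
  have "kron_mats k (outers z) $$ (p, q) = (\<Prod>i=1..k. outers z i $$ (digits n k p i, digits n k q i))"
    using assms unfolding m by (intro kron_mats_index) (auto simp: outers_carrier)
  also have "\<dots> = (\<Prod>i=1..k. z (i, False) (digits n k p i) * z (i, True) (digits n k q i))"
    using assms digits_less[of _ n k] unfolding m by (intro prod.cong) (auto simp: outers_def)
  finally show ?thesis by (simp add: prod.distrib)
qed

text \<open>A single product over all slots, from which the factor of one slot can be split off to
  prove linearity in that slot.\<close>

lemma kron_outers_index_slots:
  assumes "p < m" "q < m"
  shows "kron_mats k (outers z) $$ (p, q) =
    (\<Prod>s\<in>{1..k} \<times> UNIV. z s (digits n k (if snd s then q else p) (fst s)))"
proof -
  let ?g = "\<lambda>s. z s (digits n k (if snd s then q else p) (fst s))"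
  have "(\<Prod>s\<in>{1..k} \<times> UNIV. ?g s) = (\<Prod>i=1..k. \<Prod>r\<in>UNIV. ?g (i, r))"
    by (simp add: prod.cartesian_product split_def)
  then show ?thesis unfolding kron_outers_index[OF assms] by (simp add: UNIV_bool prod.distrib)
qed

lemma rank_kron_outers:
  assumes "p < m" "q < m" "kron_mats k (outers z) $$ (p, q) \<noteq> 0"
  shows "mat_rank (\<phi> (kron_mats k (outers z))) = 1"
proof (rule rank_one)
  show "mat_rank (kron_mats k (outers z)) = 1"
    by (rule rank_eq_1I[OF kron_outers_carrier kron_outers_index assms])
qed (rule outers_carrier)

lemma phi_nonzero:
  assumes "p < m" "q < m" "kron_mats k (outers z) $$ (p, q) \<noteq> 0"
  obtains a b where "a < m" "b < m" "\<phi> (kron_mats k (outers z)) $$ (a, b) \<noteq> 0"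
  using rank_1_nonzero[OF phi_carrier[OF kron_outers_carrier] rank_kron_outers[OF assms]] by metis

lemma phi_sum:
  assumes "finite T" and "B \<in> carrier_mat m m"
    and "\<And>p q. p < m \<Longrightarrow> q < m \<Longrightarrow> B $$ (p, q) = (\<Sum>t\<in>T. c t * kron_mats k (outers (z t)) $$ (p, q))"
    and ab: "a < m" "b < m"
  shows "\<phi> B $$ (a, b) = (\<Sum>t\<in>T. c t * F (z t) a b)"
proof -
  have "\<phi> B $$ (a, b) = (\<Sum>t\<in>T. c t * \<phi> (kron_mats k (outers (z t))) $$ (a, b))"
    by (rule linear_map_mat_sum[OF lin assms(1,2) kron_outers_carrier assms(3,4,5)])
  then show ?thesis using ab by (simp add: F_def)
qed

lemma multilinear: "rank_one_multilinear ({1..k} \<times> UNIV) (n \<circ> fst) F"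
proof
  show "finite ({1..k} \<times> (UNIV :: bool set))" by simp
  show "2 \<le> (n \<circ> fst) s" if "s \<in> {1..k} \<times> (UNIV :: bool set)" for s using that n by auto
  show "F z = F z'" if "\<And>s t. s \<in> {1..k} \<times> UNIV \<Longrightarrow> t < (n \<circ> fst) s \<Longrightarrow> z s t = z' s t" for z z'
  proof -
    have "kron_mats k (outers z) = kron_mats k (outers z')"
      using that by (intro kron_mats_cong eq_matI) (auto simp: outers_def)
    then show ?thesis by (intro ext) (simp add: F_def)
  qed
  show "F (z(s := \<lambda>t. c * x t + d * y t)) a b = c * F (z(s := x)) a b + d * F (z(s := y)) a b"
    if s: "s \<in> {1..k} \<times> UNIV" for s z c x d y a b
  proof (cases "a < m \<and> b < m")
    case True
    let ?w = "z(s := \<lambda>t. c * x t + d * y t)"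
    have "\<phi> (kron_mats k (outers ?w)) $$ (a, b) =
        (\<Sum>t\<in>{False, True}. (if t then d else c) * F (z(s := if t then y else x)) a b)"
    proof (rule phi_sum)
      fix p q assume pq: "p < m" "q < m"
      show "kron_mats k (outers ?w) $$ (p, q) = (\<Sum>t\<in>{False, True}. (if t then d else c) *
          kron_mats k (outers (z(s := if t then y else x))) $$ (p, q))"
      proof -
        define D where "D s = digits n k (if snd s then q else p) (fst s)" for s :: "nat \<times> bool"
        have "kron_mats k (outers (z(s := w))) $$ (p, q) =
            w (D s) * (\<Prod>s'\<in>{1..k} \<times> UNIV - {s}. z s' (D s'))" for w
          unfolding kron_outers_index_slots[OF pq] D_def[symmetric]
          by (subst prod.remove[OF _ s]) auto
        then show ?thesis by (simp add: algebra_simps)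
      qed
    qed (use True kron_outers_carrier in auto)
    then show ?thesis using True by (simp add: F_def)
  qed (auto simp: F_def)
  show "F z a b * F z a' b' = F z a b' * F z a' b" for z a b a' b'
  proof (cases "a < m \<and> b < m \<and> a' < m \<and> b' < m")
    case ab: True
    show ?thesis
    proof (cases "\<exists>p<m. \<exists>q<m. kron_mats k (outers z) $$ (p, q) \<noteq> 0")
      case True
      then have 1: "mat_rank (\<phi> (kron_mats k (outers z))) = 1" using rank_kron_outers by blast
      show ?thesis
        using ab rank_1_minors[OF phi_carrier[OF kron_outers_carrier] 1, of a a' b b'] by (simp add: F_def)
    next
      case False
      \<comment> \<open>The rank hypothesis says nothing about the zero matrix; as an empty
        combination it is sent to zero by linearity.\<close>
      then have "F z a b = 0" if "a < m" "b < m" for a b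
        using that phi_sum[OF finite.emptyI kron_outers_carrier[of z]] by (simp_all add: F_def)
      then show ?thesis using ab by simp
    qed
  qed (auto simp: F_def)
  show "\<exists>a b. F z a b \<noteq> 0" if nz: "\<And>s. s \<in> {1..k} \<times> UNIV \<Longrightarrow> \<exists>t<(n \<circ> fst) s. z s t \<noteq> 0" for z
  proof -
    have "\<exists>t<n i. z (i, c) t \<noteq> 0" if i: "i \<in> {1..k}" for i c
      using nz[of "(i, c)"] i by simp
    then obtain t where t: "\<And>i c. i \<in> {1..k} \<Longrightarrow> t i c < n i \<and> z (i, c) (t i c) \<noteq> 0" by metis
    obtain p where p: "p < m" "\<And>i. i \<in> {1..k} \<Longrightarrow> digits n k p i = t i False"
      unfolding m using digits_surj[of k "\<lambda>i. t i False" n] t by metis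
    obtain q where q: "q < m" "\<And>i. i \<in> {1..k} \<Longrightarrow> digits n k q i = t i True"
      unfolding m using digits_surj[of k "\<lambda>i. t i True" n] t by metis
    have "kron_mats k (outers z) $$ (p, q) \<noteq> 0"
      unfolding kron_outers_index[OF p(1) q(1)] using p q t by simp
    then obtain a b where "a < m" "b < m" "\<phi> (kron_mats k (outers z)) $$ (a, b) \<noteq> 0"
      using phi_nonzero p(1) q(1) by blast
    then show ?thesis unfolding F_def by (intro exI[of _ a] exI[of _ b]) simp
  qed
qed

text \<open>Distributes the product over decompositions of the factors into outer products. It is
  applied to rank factorizations, to bound a rank, and to unit matrices, to read off the final
  form.\<close>

lemma phi_kron_expand:
  fixes B :: "nat \<Rightarrow> 't set"
  assumes A: "\<And>i. i \<in> {1..k} \<Longrightarrow> A i \<in> carrier_mat (n i) (n i)"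
    and fin: "\<And>i. i \<in> {1..k} \<Longrightarrow> finite (B i)"
    and sum: "\<And>i p q. i \<in> {1..k} \<Longrightarrow> p < n i \<Longrightarrow> q < n i \<Longrightarrow>
      A i $$ (p, q) = (\<Sum>t\<in>B i. c i t * (x i t p * y i t q))"
    and ab: "a < m" "b < m"
  shows "\<phi> (kron_mats k A) $$ (a, b) = (\<Sum>h\<in>PiE {1..k} B. (\<Prod>i=1..k. c i (h i)) *
    F (\<lambda>(i, r). if r then y i (h i) else x i (h i)) a b)"
proof (rule phi_sum[OF _ kron_carrier[OF A] _ ab])
  show "finite (PiE {1..k} B)" using fin by (intro finite_PiE) auto
  fix p q assume pq: "p < m" "q < m"
  have "kron_mats k A $$ (p, q) = (\<Prod>i=1..k. A i $$ (digits n k p i, digits n k q i))"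
    using pq A unfolding m by (intro kron_mats_index)
  also have "\<dots> = (\<Prod>i=1..k. \<Sum>t\<in>B i. c i t * (x i t (digits n k p i) * y i t (digits n k q i)))"
    using pq digits_less[of _ n k] unfolding m by (intro prod.cong refl sum) auto
  also have "\<dots> = (\<Sum>h\<in>PiE {1..k} B. \<Prod>i=1..k. c i (h i) * (x i (h i) (digits n k p i) * y i (h i) (digits n k q i)))"
    using fin by (intro prod_sum_PiE) auto
  finally show "kron_mats k A $$ (p, q) = (\<Sum>h\<in>PiE {1..k} B. (\<Prod>i=1..k. c i (h i)) *
      kron_mats k (outers (\<lambda>(i, r). if r then y i (h i) else x i (h i))) $$ (p, q))"
    unfolding kron_outers_index[OF pq] by (simp add: prod.distrib)
qed

text \<open>If the two slots of factor \<open>j\<close> lay on the same side, then the factor \<open>X j\<close> would contribute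
  nothing to the rank of \<open>\<phi> (kron_mats k X)\<close>.\<close>

lemma rank_drop:
  assumes X: "\<And>i. i \<in> {1..k} \<Longrightarrow> X i \<in> carrier_mat (n i) (n i) \<and> mat_rank (X i) > 1"
    and j: "j \<in> {1..k}"
    and split: "\<And>z (T :: nat set) x y. \<exists>u v. \<forall>a b.
      (\<Sum>t\<in>T. F (z((j, False) := x t, (j, True) := y t)) a b) = u a * v b"
  shows "mat_rank (\<phi> (kron_mats k X)) < mat_rank (kron_mats k X)"
proof -
  have "\<exists>J V. indep_cols (X i) J \<and> card J = mat_rank (X i) \<and>
      (\<forall>p<dim_row (X i). \<forall>q<dim_col (X i). X i $$ (p, q) = (\<Sum>l\<in>J. X i $$ (p, l) * V l q))" for i
    using rank_factorization[of "X i"] by metis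
  then obtain J V where J: "\<And>i. indep_cols (X i) (J i)" "\<And>i. card (J i) = mat_rank (X i)"
    and V: "\<And>i p q. p < dim_row (X i) \<Longrightarrow> q < dim_col (X i) \<Longrightarrow>
      X i $$ (p, q) = (\<Sum>l\<in>J i. X i $$ (p, l) * V i l q)"
    by metis
  have fJ: "finite (J i)" for i using J(1)[of i] finite_subset unfolding indep_cols_def by blast
  have cJ: "card (J i) > 1" if "i \<in> {1..k}" for i using J(2) X that by simp
  let ?I = "{1..k} - {j}"
  have I: "{1..k} = insert j ?I" using j by blast
  define z where "z h = (\<lambda>(i, r). if r then V i (h i) else (\<lambda>p. X i $$ (p, h i)))" for h :: "nat \<Rightarrow> nat"
  have z_upd: "z (h(j := t)) = (z h)((j, False) := (\<lambda>p. X j $$ (p, t)), (j, True) := V j t)" for h t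
    by (auto simp: z_def fun_eq_iff)
  \<comment> \<open>With the other indices fixed, the sum over the terms of \<open>X j\<close> is a
    single outer product by \<open>split\<close>; the terms left are indexed by the remaining
    factors.\<close>
  define G where "G h a b =
    (\<Sum>t\<in>J j. F ((z h)((j, False) := (\<lambda>p. X j $$ (p, t)), (j, True) := V j t)) a b)" for h a b
  have "\<exists>u v. \<forall>a b. G h a b = u a * v b" for h unfolding G_def by (rule split)
  then obtain u v where uv: "\<And>h a b. G h a b = u h a * v h b" by metis
  have "\<phi> (kron_mats k X) $$ (a, b) = (\<Sum>h\<in>PiE ?I J. u h a * v h b)" if "a < m" "b < m" for a b
  proof -
    have "\<phi> (kron_mats k X) $$ (a, b) = (\<Sum>h\<in>PiE {1..k} J. (\<Prod>i=1..k. 1) * F (z h) a b)"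
      unfolding z_def
    proof (rule phi_kron_expand[OF _ fJ _ that])
      fix i p q assume i: "i \<in> {1..k}" and pq: "p < n i" "q < n i"
      have "X i \<in> carrier_mat (n i) (n i)" using X i by blast
      then show "X i $$ (p, q) = (\<Sum>t\<in>J i. 1 * (X i $$ (p, t) * V i t q))"
        using V[of p i q] pq by simp
    qed (use X in blast)
    also have "\<dots> = (\<Sum>h\<in>PiE (insert j ?I) J. F (z h) a b)" using I by simp
    also have "\<dots> = (\<Sum>(t, h)\<in>J j \<times> PiE ?I J. F (z (h(j := t))) a b)"
      unfolding PiE_insert_eq
      by (subst sum.reindex[OF inj_combinator]) (auto simp: case_prod_unfold o_def)
    also have "\<dots> = (\<Sum>h\<in>PiE ?I J. \<Sum>t\<in>J j. F (z (h(j := t))) a b)"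
      unfolding sum.cartesian_product[symmetric] by (rule sum.swap)
    finally show ?thesis unfolding z_upd G_def[symmetric] uv .
  qed
  then have "mat_rank (\<phi> (kron_mats k X)) \<le> card (PiE ?I J)"
    using X fJ by (intro rank_le_outer_sum[OF phi_carrier[OF kron_carrier]] finite_PiE) auto
  also have "\<dots> = (\<Prod>i\<in>?I. card (J i))" by (simp add: card_PiE)
  \<comment> \<open>Strictness comes from \<open>card (J j) > 1\<close> and the positivity of the
    remaining product.\<close>
  also have "\<dots> < card (J j) * (\<Prod>i\<in>?I. card (J i))"
  proof -
    have "(\<Prod>i\<in>?I. card (J i)) > 0" using cJ by (intro prod_pos) force
    then show ?thesis using cJ[OF j] by simp
  qed
  also have "\<dots> = (\<Prod>i=1..k. card (J i))" using j by (simp add: prod.remove)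
  also have "\<dots> \<le> mat_rank (kron_mats k X)"
    using indep_cols_kron_mats[of k X J] J(1) indep_cols_rank by metis
  finally show ?thesis .
qed

text \<open>If both slots of \<open>j\<close> are on one side, the factor of the other side does not
  depend on them and leaves the sum over \<open>t\<close>. The sum is then an outer product, and
  \<open>rank_drop\<close> contradicts the equality of ranks.\<close>

lemma factorization_sides:
  assumes FL: "\<And>z a b. F z a b = f z a * g z b"
    and f: "\<And>z z'. \<forall>s\<in>L. z s = z' s \<Longrightarrow> f z = f z'"
    and g: "\<And>z z'. \<forall>s\<in>{1..k} \<times> UNIV - L. z s = z' s \<Longrightarrow> g z = g z'"
    and X: "\<And>i. i \<in> {1..k} \<Longrightarrow> X i \<in> carrier_mat (n i) (n i) \<and> mat_rank (X i) > 1"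
      "mat_rank (\<phi> (kron_mats k X)) = mat_rank (kron_mats k X)"
    and j: "j \<in> {1..k}"
  shows "(j, False) \<in> L \<longleftrightarrow> (j, True) \<notin> L"
proof (rule ccontr)
  assume same: "\<not> ((j, False) \<in> L \<longleftrightarrow> (j, True) \<notin> L)"
  have "\<exists>u v. \<forall>a b. (\<Sum>t\<in>T. F (z((j, False) := x t, (j, True) := y t)) a b) = u a * v b"
    for z and T :: "nat set" and x y
  proof (cases "(j, False) \<in> L")
    case True
    with same have "g (z((j, False) := x t, (j, True) := y t)) = g z" for t by (intro g) auto
    then have "\<forall>a b. (\<Sum>t\<in>T. F (z((j, False) := x t, (j, True) := y t)) a b) =
        (\<Sum>t\<in>T. f (z((j, False) := x t, (j, True) := y t)) a) * g z b"
      by (simp add: FL sum_distrib_right)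
    then show ?thesis
      by (intro exI[of _ "\<lambda>a. \<Sum>t\<in>T. f (z((j, False) := x t, (j, True) := y t)) a"] exI[of _ "g z"])
  next
    case False
    with same have "f (z((j, False) := x t, (j, True) := y t)) = f z" for t by (intro f) auto
    then have "\<forall>a b. (\<Sum>t\<in>T. F (z((j, False) := x t, (j, True) := y t)) a b) =
        f z a * (\<Sum>t\<in>T. g (z((j, False) := x t, (j, True) := y t)) b)"
      by (simp add: FL sum_distrib_left)
    then show ?thesis
      by (intro exI[of _ "\<lambda>b. \<Sum>t\<in>T. g (z((j, False) := x t, (j, True) := y t)) b"] exI[of _ "f z"])
  qed
  then show False using rank_drop[OF X(1) j] X(2) by simp
qed

section \<open>The form of \<phi> on Kronecker products\<close>

lemma phi_kron_units:
  assumes A: "\<And>i. i \<in> {1..k} \<Longrightarrow> A i \<in> carrier_mat (n i) (n i)" and ab: "a < m" "b < m"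
  shows "\<phi> (kron_mats k A) $$ (a, b) = (\<Sum>h\<in>(\<Pi>\<^sub>E i\<in>{1..k}. {..<n i} \<times> {..<n i}).
    (\<Prod>i=1..k. A i $$ h i) *
    F (\<lambda>(i, r). if r then unit_fun (snd (h i)) else unit_fun (fst (h i))) a b)"
proof (rule phi_kron_expand[OF A _ _ ab])
  fix i p q assume i: "i \<in> {1..k}" and pq: "p < n i" "q < n i"
  have "(\<Sum>t\<in>{..<n i} \<times> {..<n i}. A i $$ t * (unit_fun (fst t) p * unit_fun (snd t) q)) =
      (\<Sum>t\<in>{..<n i} \<times> {..<n i}. if t = (p, q) then A i $$ t else 0)"
    by (intro sum.cong) (auto simp: unit_fun_def)
  then show "A i $$ (p, q) =
      (\<Sum>t\<in>{..<n i} \<times> {..<n i}. A i $$ t * (unit_fun (fst t) p * unit_fun (snd t) q))"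
    using pq by simp
qed auto

lemma sum_digits:
  assumes "\<And>P Q. (\<And>i. i \<in> {1..k} \<Longrightarrow> P i = Q i) \<Longrightarrow> H P = H Q"
  shows "(\<Sum>p<m. H (digits n k p)) = (\<Sum>P\<in>(\<Pi>\<^sub>E i\<in>{1..k}. {..<n i}). H P)"
proof -
  have "(\<Sum>p<m. H (digits n k p)) = (\<Sum>p<m. H (restrict (digits n k p) {1..k}))"
    by (intro sum.cong refl assms) simp
  also have "\<dots> = (\<Sum>P\<in>(\<Pi>\<^sub>E i\<in>{1..k}. {..<n i}). H P)"
    using sum.reindex_bij_betw[OF bij_betw_digits[of n k]] unfolding m by simp
  finally show ?thesis .
qed

text \<open>Column \<open>p\<close> of \<open>M\<close> is \<open>f\<close> at the unit vectors
  given by the digits of \<open>p\<close>, placed in both slots of each factor; \<open>f\<close>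
  reads just one of the two, and likewise for \<open>g\<close> and \<open>N\<close>. The transpose
  appears where the left slot is the row vector, since the left index is then the column index of
  \<open>A i\<close>.\<close>

lemma phi_form:
  assumes FL: "\<And>z a b. F z a b = f z a * g z b"
    and f: "\<And>z z'. \<forall>s\<in>L. z s = z' s \<Longrightarrow> f z = f z'"
    and g: "\<And>z z'. \<forall>s\<in>{1..k} \<times> UNIV - L. z s = z' s \<Longrightarrow> g z = g z'"
    and LS: "L \<subseteq> {1..k} \<times> UNIV"
    and L: "\<And>j. j \<in> {1..k} \<Longrightarrow> (j, False) \<in> L \<longleftrightarrow> (j, True) \<notin> L"
    and A: "\<And>i. i \<in> {1..k} \<Longrightarrow> A i \<in> carrier_mat (n i) (n i)"
  defines "M \<equiv> mat m m (\<lambda>(a, p). f (\<lambda>(i, r). unit_fun (digits n k p i)) a)"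
    and "N \<equiv> mat m m (\<lambda>(b, q). g (\<lambda>(i, r). unit_fun (digits n k q i)) b)"
    and "\<psi> \<equiv> \<lambda>i. if (i, False) \<in> L then id else transpose_mat"
  shows "\<phi> (kron_mats k A) = M * kron_mats k (\<lambda>j. \<psi> j (A j)) * transpose_mat N"
proof (rule eq_matI)
  have MN: "M \<in> carrier_mat m m" "N \<in> carrier_mat m m" by (simp_all add: M_def N_def)
  have \<psi>A: "\<psi> i (A i) \<in> carrier_mat (n i) (n i)" if "i \<in> {1..k}" for i
    using A[OF that] by (simp add: \<psi>_def)
  have K: "kron_mats k (\<lambda>j. \<psi> j (A j)) \<in> carrier_mat m m" by (rule kron_carrier[OF \<psi>A])
  have \<phi>K: "\<phi> (kron_mats k A) \<in> carrier_mat m m" by (rule phi_carrier[OF kron_carrier[OF A]])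
  show "dim_row (\<phi> (kron_mats k A)) = dim_row (M * kron_mats k (\<lambda>j. \<psi> j (A j)) * transpose_mat N)"
    "dim_col (\<phi> (kron_mats k A)) = dim_col (M * kron_mats k (\<lambda>j. \<psi> j (A j)) * transpose_mat N)"
    using MN \<phi>K by auto
  fix a b
  assume "a < dim_row (M * kron_mats k (\<lambda>j. \<psi> j (A j)) * transpose_mat N)"
    and "b < dim_col (M * kron_mats k (\<lambda>j. \<psi> j (A j)) * transpose_mat N)"
  then have ab: "a < m" "b < m" using MN by auto
  define u where "u P = f (\<lambda>(i, r). unit_fun (P i)) a" for P :: "nat \<Rightarrow> nat"
  define v where "v Q = g (\<lambda>(i, r). unit_fun (Q i)) b" for Q :: "nat \<Rightarrow> nat"
  define c where "c P Q = (\<Prod>i=1..k. \<psi> i (A i) $$ (P i, Q i))" for P Q :: "nat \<Rightarrow> nat"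
  have u_cong: "u P = u Q" if "\<And>i. i \<in> {1..k} \<Longrightarrow> P i = Q i" for P Q
  proof -
    have "f (\<lambda>(i, r). unit_fun (P i)) = f (\<lambda>(i, r). unit_fun (Q i))"
      using LS that by (intro f) auto
    then show ?thesis by (simp add: u_def)
  qed
  have v_cong: "v P = v Q" if "\<And>i. i \<in> {1..k} \<Longrightarrow> P i = Q i" for P Q
  proof -
    have "g (\<lambda>(i, r). unit_fun (P i)) = g (\<lambda>(i, r). unit_fun (Q i))"
      using that by (intro g) auto
    then show ?thesis by (simp add: v_def)
  qed
  have c_cong: "c P Q = c P' Q'" if "\<And>i. i \<in> {1..k} \<Longrightarrow> P i = P' i \<and> Q i = Q' i" for P Q P' Q'
    unfolding c_def using that by (intro prod.cong) auto
  \<comment> \<open>\<open>join\<close> turns a left and a right multi-index into the (row, column)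
    positions in the \<open>A i\<close>; \<open>lo\<close> and \<open>hi\<close> recover the left
    and the right one. This is the bijection behind the exchange of sums below.\<close>
  define join where
    "join P Q = restrict (\<lambda>i. if (i, False) \<in> L then (P i, Q i) else (Q i, P i)) {1..k}"
    for P Q :: "nat \<Rightarrow> nat"
  define lo where "lo h = restrict (\<lambda>i. if (i, False) \<in> L then fst (h i) else snd (h i)) {1..k}"
    for h :: "nat \<Rightarrow> nat \<times> nat"
  define hi where "hi h = restrict (\<lambda>i. if (i, False) \<in> L then snd (h i) else fst (h i)) {1..k}"
    for h :: "nat \<Rightarrow> nat \<times> nat"
  let ?D = "\<Pi>\<^sub>E i\<in>{1..k}. {..<n i}" and ?D2 = "\<Pi>\<^sub>E i\<in>{1..k}. {..<n i} \<times> {..<n i}"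
  have "(M * kron_mats k (\<lambda>j. \<psi> j (A j)) * transpose_mat N) $$ (a, b) =
      (\<Sum>q<m. (\<Sum>p<m. M $$ (a, p) * kron_mats k (\<lambda>j. \<psi> j (A j)) $$ (p, q)) * N $$ (b, q))"
    using MN K ab by (simp add: scalar_prod_def atLeast0LessThan del: assoc_mult_mat)
  also have "\<dots> = (\<Sum>q<m. (\<Sum>p<m. u (digits n k p) * c (digits n k p) (digits n k q)) * v (digits n k q))"
  proof (intro sum.cong refl arg_cong2[where f = "(*)"])
    fix p q assume "q \<in> {..<m}" "p \<in> {..<m}"
    then show "M $$ (a, p) = u (digits n k p)" "N $$ (b, q) = v (digits n k q)"
      "kron_mats k (\<lambda>j. \<psi> j (A j)) $$ (p, q) = c (digits n k p) (digits n k q)"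
      using ab kron_mats_index[where k = k and n = n and p = p and q = q, OF \<psi>A]
      by (simp_all add: M_def N_def u_def v_def c_def m)
  qed
  also have "\<dots> = (\<Sum>Q\<in>?D. (\<Sum>P\<in>?D. u P * c P Q) * v Q)"
  proof -
    have "(\<Sum>p<m. u (digits n k p) * c (digits n k p) Q) = (\<Sum>P\<in>?D. u P * c P Q)" for Q
      by (rule sum_digits) (use u_cong c_cong in metis)
    then show ?thesis
      by (simp only:) (rule sum_digits, use v_cong c_cong in \<open>metis (no_types, lifting) sum.cong\<close>)
  qed
  also have "\<dots> = (\<Sum>(Q, P)\<in>?D \<times> ?D. u P * c P Q * v Q)"
    by (simp add: sum_distrib_right sum.cartesian_product)
  also have "\<dots> = (\<Sum>h\<in>?D2. (\<Prod>i=1..k. A i $$ h i) *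
      F (\<lambda>(i, r). if r then unit_fun (snd (h i)) else unit_fun (fst (h i))) a b)"
  proof (rule sum.reindex_bij_witness[where i = "\<lambda>h. (hi h, lo h)" and j = "\<lambda>(Q, P). join P Q"])
    fix h assume h: "h \<in> ?D2"
    have lt: "fst (h i) < n i" "snd (h i) < n i" if "i \<in> {1..k}" for i
      using PiE_mem[OF h that] by auto
    show "(hi h, lo h) \<in> ?D \<times> ?D" using lt by (auto simp: lo_def hi_def)
    show "(case (hi h, lo h) of (Q, P) \<Rightarrow> join P Q) = h"
      using h by (auto simp: join_def lo_def hi_def fun_eq_iff PiE_def extensional_def)
  next
    fix QP assume "QP \<in> ?D \<times> ?D"
    then obtain P Q where QP: "QP = (Q, P)" "P \<in> ?D" "Q \<in> ?D" by auto
    define h where "h = join P Q"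
    have h: "(case QP of (Q, P) \<Rightarrow> join P Q) = h" by (simp add: QP h_def)
    have lt: "P i < n i" "Q i < n i" if "i \<in> {1..k}" for i
      using PiE_mem[OF QP(2) that] PiE_mem[OF QP(3) that] by auto
    show "(case QP of (Q, P) \<Rightarrow> join P Q) \<in> ?D2" unfolding h using lt by (auto simp: h_def join_def)
    have "hi h = Q" "lo h = P"
      using QP by (auto simp: h_def join_def lo_def hi_def fun_eq_iff PiE_def extensional_def)
    then show "(hi (case QP of (Q, P) \<Rightarrow> join P Q), lo (case QP of (Q, P) \<Rightarrow> join P Q)) = QP"
      unfolding h by (simp add: QP)
    let ?z = "\<lambda>(i, r). if r then unit_fun (snd (h i)) else unit_fun (fst (h i))"
    have "f ?z a = u P"
    proof -
      have "f ?z = f (\<lambda>(i, r). unit_fun (P i))"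
      proof (intro f ballI)
        fix s assume s: "s \<in> L"
        then have "fst s \<in> {1..k}" using LS by auto
        then show "?z s = (\<lambda>(i, r). unit_fun (P i)) s"
          using s L[of "fst s"] by (cases s) (auto simp: h_def join_def)
      qed
      then show ?thesis by (simp add: u_def)
    qed
    moreover have "g ?z b = v Q"
    proof -
      have "g ?z = g (\<lambda>(i, r). unit_fun (Q i))"
        using L by (intro g) (auto simp: h_def join_def)
      then show ?thesis by (simp add: v_def)
    qed
    moreover have "(\<Prod>i=1..k. A i $$ h i) = c P Q"
      unfolding c_def
    proof (rule prod.cong)
      fix i assume i: "i \<in> {1..k}"
      then have "P i < n i" "Q i < n i" using QP by auto
      then show "A i $$ h i = \<psi> i (A i) $$ (P i, Q i)" using A[OF i] i by (auto simp: h_def join_def \<psi>_def)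
    qed simp
    ultimately show "(\<Prod>i=1..k. A i $$ (case QP of (Q, P) \<Rightarrow> join P Q) i) *
        F (\<lambda>(i, r). if r then unit_fun (snd ((case QP of (Q, P) \<Rightarrow> join P Q) i))
          else unit_fun (fst ((case QP of (Q, P) \<Rightarrow> join P Q) i))) a b =
        (case QP of (Q, P) \<Rightarrow> u P * c P Q * v Q)"
      unfolding h FL by (simp add: QP)
  qed
  also have "\<dots> = \<phi> (kron_mats k A) $$ (a, b)" by (rule phi_kron_units[OF A ab, symmetric])
  finally show "\<phi> (kron_mats k A) $$ (a, b) =
      (M * kron_mats k (\<lambda>j. \<psi> j (A j)) * transpose_mat N) $$ (a, b)" ..
qed

end

theorem corollary3p5:
  fixes k m :: nat and n :: "nat \<Rightarrow> nat" and \<phi> :: "complex mat \<Rightarrow> complex mat"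
  assumes k: "k \<ge> 1"
    and n: "\<And>i. i \<in> {1..k} \<Longrightarrow> n i \<ge> 2"
    and m: "m = (\<Prod>i=1..k. n i)"
    and lin: "linear_map_mat m \<phi>"
    and rank_one: "\<And>A. (\<And>i. i \<in> {1..k} \<Longrightarrow> A i \<in> carrier_mat (n i) (n i)) \<Longrightarrow>
        mat_rank (kron_mats k A) = 1 \<Longrightarrow> mat_rank (\<phi> (kron_mats k A)) = 1"
    and ex_X: "\<exists>X. (\<forall>i\<in>{1..k}. X i \<in> carrier_mat (n i) (n i) \<and> mat_rank (X i) > 1) \<and>
        mat_rank (\<phi> (kron_mats k X)) = mat_rank (kron_mats k X)"
  shows "\<exists>M\<in>carrier_mat m m. \<exists>N\<in>carrier_mat m m. \<exists>\<psi> :: nat \<Rightarrow> complex mat \<Rightarrow> complex mat.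
      (\<forall>j\<in>{1..k}. \<psi> j = id \<or> \<psi> j = transpose_mat) \<and>
      mat_kernel M \<inter> decomposable_vecs k n = {0\<^sub>v m} \<and>
      mat_kernel N \<inter> decomposable_vecs k n = {0\<^sub>v m} \<and>
      (\<forall>A. (\<forall>i\<in>{1..k}. A i \<in> carrier_mat (n i) (n i)) \<longrightarrow>
        \<phi> (kron_mats k A) = M * kron_mats k (\<lambda>j. \<psi> j (A j)) * transpose_mat N)"
proof -
  interpret rank_one_preserver k m n \<phi>
    by (rule rank_one_preserver.intro, fact n, fact m, fact lin, fact rank_one)
  interpret F: rank_one_multilinear "{1..k} \<times> UNIV" "n \<circ> fst" F by (rule multilinear)
  obtain L f g where LS: "L \<subseteq> {1..k} \<times> UNIV" and FL: "\<And>z a b. F z a b = f z a * g z b"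
    and f: "\<And>z z'. \<forall>s\<in>L. z s = z' s \<Longrightarrow> f z = f z'"
    and g: "\<And>z z'. \<forall>s\<in>{1..k} \<times> UNIV - L. z s = z' s \<Longrightarrow> g z = g z'"
    using F.factorization by blast
  obtain X where X: "\<And>i. i \<in> {1..k} \<Longrightarrow> X i \<in> carrier_mat (n i) (n i) \<and> mat_rank (X i) > 1"
    "mat_rank (\<phi> (kron_mats k X)) = mat_rank (kron_mats k X)"
    using ex_X by blast
  have L: "(j, False) \<in> L \<longleftrightarrow> (j, True) \<notin> L" if "j \<in> {1..k}" for j
    using factorization_sides[OF FL f g X that] .
  define M where "M = mat m m (\<lambda>(a, p). f (\<lambda>(i, r). unit_fun (digits n k p i)) a)"
  define N where "N = mat m m (\<lambda>(b, q). g (\<lambda>(i, r). unit_fun (digits n k q i)) b)"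
  define \<psi> where "\<psi> = (\<lambda>i. if (i, False) \<in> L then id else transpose_mat :: complex mat \<Rightarrow> complex mat)"
  have form: "\<phi> (kron_mats k A) = M * kron_mats k (\<lambda>j. \<psi> j (A j)) * transpose_mat N"
    if "\<And>i. i \<in> {1..k} \<Longrightarrow> A i \<in> carrier_mat (n i) (n i)" for A
    unfolding M_def N_def \<psi>_def by (rule phi_form[OF FL f g LS L that])
  have MN: "M \<in> carrier_mat m m" "N \<in> carrier_mat m m" by (simp_all add: M_def N_def)
  have zero: "0\<^sub>v m \<in> decomposable_vecs k n"
  proof -
    have 0: "0\<^sub>v (n i) \<in> carrier_vec (n i)" for i by simp
    have "kron_vecs k (\<lambda>i. 0\<^sub>v (n i)) = (0\<^sub>v m :: complex vec)"
    proof (rule eq_vecI)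
      show "dim_vec (kron_vecs k (\<lambda>i. 0\<^sub>v (n i) :: complex vec)) = dim_vec (0\<^sub>v m :: complex vec)"
        using kron_vecs_carrier[of k "\<lambda>i. 0\<^sub>v (n i) :: complex vec" n] by (simp add: m)
      fix p assume "p < dim_vec (0\<^sub>v m :: complex vec)"
      then have p: "p < m" by simp
      have "kron_vecs k (\<lambda>i. 0\<^sub>v (n i) :: complex vec) $ p = (\<Prod>i=1..k. 0\<^sub>v (n i) $ digits n k p i)"
        using p unfolding m by (intro kron_vecs_index) auto
      \<comment> \<open>\<open>k \<ge> 1\<close> provides a zero factor; the empty product would be
        1.\<close>
      also have "\<dots> = 0"
        using k p digits_less[of p n k 1] unfolding m by (intro prod_zero bexI[of _ 1]) auto
      finally show "kron_vecs k (\<lambda>i. 0\<^sub>v (n i)) $ p = (0\<^sub>v m :: complex vec) $ p" using p by simp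
    qed
    then show ?thesis unfolding decomposable_vecs_def using 0 by (smt (verit) mem_Collect_eq)
  qed
  text \<open>The matrices \<open>x\<^sub>i x\<^sub>i\<^sup>T\<close> are symmetric, so all \<open>\<psi> i\<close> fix them.\<close>
  have ker: "v = 0\<^sub>v m" if v: "v \<in> decomposable_vecs k n" and ker: "v \<in> mat_kernel M \<union> mat_kernel N" for v
  proof (rule ccontr)
    assume "v \<noteq> 0\<^sub>v m"
    obtain x where x: "\<And>i. i \<in> {1..k} \<Longrightarrow> x i \<in> carrier_vec (n i)" and vx: "v = kron_vecs k x"
      using v unfolding decomposable_vecs_def by blast
    have vm: "v \<in> carrier_vec m" unfolding vx m by (rule kron_vecs_carrier[OF x])
    define z where "z = (\<lambda>(i :: nat, r :: bool) t. x i $ t)"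
    define K where "K = kron_mats k (outers z)"
    have K: "K \<in> carrier_mat m m" unfolding K_def by (rule kron_outers_carrier)
    \<comment> \<open>\<open>K\<close> is v v^T, so \<open>\<phi> K\<close> is (M v)(N v)^T. One
      nonzero entry of it keeps \<open>v\<close> out of both kernels at once.\<close>
    have K_ix: "K $$ (p, q) = v $ p * v $ q" if "p < m" "q < m" for p q
    proof -
      have "v $ p = (\<Prod>i=1..k. x i $ digits n k p i)" if "p < m" for p
        unfolding vx using x that unfolding m by (rule kron_vecs_index)
      then show ?thesis unfolding K_def kron_outers_index[OF that] using that by (simp add: z_def)
    qed
    obtain p where p: "p < m" "v $ p \<noteq> 0" using \<open>v \<noteq> 0\<^sub>v m\<close> vm by (metis carrier_vecD eq_vecI index_zero_vec)
    then have "K $$ (p, p) \<noteq> 0" using K_ix by simp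
    then obtain a b where ab: "a < m" "b < m" "\<phi> K $$ (a, b) \<noteq> 0"
      unfolding K_def using phi_nonzero p(1) by metis
    have "transpose_mat (outers z i) = outers z i" for i
      by (rule eq_matI) (auto simp: outers_def z_def)
    then have "\<psi> i (outers z i) = outers z i" for i by (simp add: \<psi>_def)
    then have \<phi>K: "\<phi> K = M * K * transpose_mat N"
      unfolding K_def by (subst form) (auto simp: outers_carrier)
    have MK: "(M * K) $$ (a, q) = (M *\<^sub>v v) $ a * v $ q" if "q < m" for q
      using MN K that ab vm K_ix
      by (auto simp: scalar_prod_def sum_distrib_right mult.assoc intro!: sum.cong)
    have "\<phi> K $$ (a, b) = (\<Sum>q<m. (M * K) $$ (a, q) * N $$ (b, q))"
      unfolding \<phi>K using MN K ab
      by (subst index_mult_mat) (auto simp: scalar_prod_def atLeast0LessThan intro!: sum.cong)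
    also have "\<dots> = (M *\<^sub>v v) $ a * (\<Sum>q<m. N $$ (b, q) * v $ q)"
      by (simp add: MK sum_distrib_left mult_ac)
    also have "(\<Sum>q<m. N $$ (b, q) * v $ q) = (N *\<^sub>v v) $ b"
      using MN ab vm by (auto simp: scalar_prod_def atLeast0LessThan intro!: sum.cong)
    also have "(M *\<^sub>v v) $ a * (N *\<^sub>v v) $ b = 0"
    proof -
      have "M *\<^sub>v v = 0\<^sub>v m \<or> N *\<^sub>v v = 0\<^sub>v m" using ker MN by (auto simp: mat_kernel_def)
      then show ?thesis using ab by (metis index_zero_vec(1) mult_zero_left mult_zero_right)
    qed
    finally show False using ab(3) by simp
  qed
  have zero_ker: "0\<^sub>v m \<in> mat_kernel M" "0\<^sub>v m \<in> mat_kernel N"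
    using MN by (auto simp: mat_kernel_def)
  show ?thesis
  proof (rule bexI[OF _ MN(1)], rule bexI[OF _ MN(2)], rule exI[of _ \<psi>], intro conjI)
    show "\<forall>j\<in>{1..k}. \<psi> j = id \<or> \<psi> j = transpose_mat" by (simp add: \<psi>_def)
    show "mat_kernel M \<inter> decomposable_vecs k n = {0\<^sub>v m}"
      using zero zero_ker(1) ker by blast
    show "mat_kernel N \<inter> decomposable_vecs k n = {0\<^sub>v m}"
      using zero zero_ker(2) ker by blast
    show "\<forall>A. (\<forall>i\<in>{1..k}. A i \<in> carrier_mat (n i) (n i)) \<longrightarrow>
        \<phi> (kron_mats k A) = M * kron_mats k (\<lambda>j. \<psi> j (A j)) * transpose_mat N"
      using form by blast
  qed
qed

end
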